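(* Let $q$ be a prime power, $n\ge2$, let $r_1,r_2$ be positive divisors of $n$, and let $\alpha\in\mathbb{F}_{q^n}^*$. Consider in $\mathrm{PG}(1,q^n)$ \[L_{r_1}=\{\langle (x,\mathrm{Tr}_{q^n/q^{r_1}}(x))\rangle_{\mathbb{F}_{q^n}}\colon x\in\mathbb{F}_{q^n}^*\},\qquad \sigma(L_{r_2})=\{\langle (\alpha\,\mathrm{Tr}_{q^n/q^{r_2}}(y),y)\rangle_{\mathbb{F}_{q^n}}\colon y\in\mathbb{F}_{q^n}^*\}.\] If $\frac n2\ge r_1+r_2+1$, then $L_{r_1}\cap\sigma(L_{r_2})\neq\emptyset$.
   Context: For a divisor $r$ of $n$, $\mathrm{Tr}_{q^n/q^r}(x)=\sum_{i=0}^{n/r-1}x^{q^{ir}}$. $\sigma$ denotes the projectivity $\langle (X_0,X_1)\rangle_{\mathbb{F}_{q^n}}\mapsto\langle(X_1,X_0)\rangle_{\mathbb{F}_{q^n}}$ of $\mathrm{PG}(1,q^n)$. *)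

theory Defs
  imports "HOL-Computational_Algebra.Primes"
begin

definition rtrace :: "nat \<Rightarrow> nat \<Rightarrow> nat \<Rightarrow> 'a::field \<Rightarrow> 'a" where
  "rtrace q n r x = (\<Sum>i<n div r. x ^ (q ^ (i * r)))"

text \<open>The point of PG(1,F) spanned by a nonzero vector (a,b): its set of
  nonzero scalar multiples (the equivalence class).\<close>
definition proj_point :: "'a::field \<times> 'a \<Rightarrow> ('a \<times> 'a) set" where
  "proj_point v = {(c * fst v, c * snd v) | c. c \<noteq> 0}"

definition L_set :: "nat \<Rightarrow> nat \<Rightarrow> nat \<Rightarrow> (('a::field) \<times> 'a) set set" where
  "L_set q n r = {proj_point (x, rtrace q n r x) | x. x \<noteq> 0}"

end

theory Submission
  imports Defs "HOL-Algebra.Algebraic_Closure_Type" "HOL-Number_Theory.Residues"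
begin

text \<open>
  A common point amounts to \<open>x, y \<noteq> 0\<close> with \<open>x y = \<alpha> Tr\<^sub>1(x) Tr\<^sub>2(y)\<close>. Fixing nonzero values \<open>A, B\<close> of
  the two traces and putting \<open>\<beta> = \<alpha> A B\<close>, it suffices to find \<open>x\<close> with \<open>Tr\<^sub>1(x) = A\<close> and \<open>Tr\<^sub>2(\<beta>/x) = B\<close>.
  Detecting both conditions by additive characters turns the number of such \<open>x\<close> into a sum of
  Kloosterman sums \<open>K(a, b\<beta>)\<close> with \<open>a, b\<close> in the two subfields, and the Weil bound
  \<open>\<bar>K\<bar> \<le> 2 \<surd>Q\<close> makes the main term win.

  The Weil bound is obtained elementarily. Let \<open>K\<close> and \<open>K'\<close> be the sums with the same parameters over the
  fields with \<open>Q\<close> and \<open>Q\<^sup>2\<close> elements. Counting quadratic polynomials by their roots gives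
  \<open>K' = 2 Q - K\<^sup>2\<close>, so \<open>t = K / \<surd>Q\<close> evolves by \<open>t' = 2 - t\<^sup>2\<close> under quadratic extensions and would
  be unbounded if \<open>\<bar>t\<bar> > 2\<close>. On the other hand Stepanov's method, applied to the Artin-Schreier curve
  \<open>y\<^sup>p - y = a x + b/x - \<theta>\<close>, bounds \<open>t\<close> by a constant that depends on \<open>p\<close> only.
\<close>

hide_const (open) Divisibility.prime

subsection \<open>Finite subfields, traces and additive characters\<close>

text \<open>All finite fields of the argument are sets inside one algebraically closed type, as
  fixed points of powers of Frobenius. Passing to a quadratic extension then changes only the
  parameter \<open>m\<close>.\<close>

definition gf :: "nat \<Rightarrow> 'b::field_prime_char set" where
  "gf m = {x. x ^ (CHAR('b) ^ m) = x}"

definition abs_tr :: "nat \<Rightarrow> 'b::field_prime_char \<Rightarrow> 'b" where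
  "abs_tr m x = (\<Sum>i<m. x ^ (CHAR('b) ^ i))"

lemma frob_add: "(x + y :: 'b::field_prime_char) ^ (CHAR('b) ^ m) = x ^ (CHAR('b) ^ m) + y ^ (CHAR('b) ^ m)"
  by (rule freshmans_dream') auto

lemma frob_sum: "(sum f A :: 'b::field_prime_char) ^ (CHAR('b) ^ m) = (\<Sum>x\<in>A. f x ^ (CHAR('b) ^ m))"
  by (rule freshmans_dream_sum') auto

lemma frob_uminus: "(- x :: 'b::field_prime_char) ^ (CHAR('b) ^ m) = - (x ^ (CHAR('b) ^ m))"
proof -
  have "(- x) ^ (CHAR('b) ^ m) + x ^ (CHAR('b) ^ m) = 0"
    by (simp flip: frob_add add: power_0_left)
  thus ?thesis by (simp add: eq_neg_iff_add_eq_0)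
qed

lemma frob_diff: "(x - y :: 'b::field_prime_char) ^ (CHAR('b) ^ m) = x ^ (CHAR('b) ^ m) - y ^ (CHAR('b) ^ m)"
  using frob_add[of x "-y" m] by (simp add: frob_uminus)

lemma gf_iff: "x \<in> gf m \<longleftrightarrow> x ^ (CHAR('b) ^ m) = (x::'b::field_prime_char)"
  by (simp add: gf_def)

lemma gf_0 [simp]: "0 \<in> gf m" and gf_1 [simp]: "1 \<in> gf m"
  by (auto simp: gf_iff power_0_left)

lemma gf_add: "x \<in> gf m \<Longrightarrow> y \<in> gf m \<Longrightarrow> x + y \<in> gf m"
  and gf_diff: "x \<in> gf m \<Longrightarrow> y \<in> gf m \<Longrightarrow> x - y \<in> gf m"
  and gf_uminus: "x \<in> gf m \<Longrightarrow> - x \<in> gf m"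
  and gf_mult: "x \<in> gf m \<Longrightarrow> y \<in> gf m \<Longrightarrow> x * y \<in> gf m"
  and gf_divide: "x \<in> gf m \<Longrightarrow> y \<in> gf m \<Longrightarrow> x / y \<in> gf m"
  and gf_power: "x \<in> gf m \<Longrightarrow> x ^ k \<in> gf m"
  by (auto simp: gf_iff frob_add frob_diff frob_uminus power_mult_distrib power_divide
      simp flip: power_mult) (metis mult.commute power_mult)

lemma gf_of_nat: "of_nat c \<in> gf m"
  by (induction c) (auto intro: gf_add)

lemmas gf_closed = gf_0 gf_1 gf_add gf_diff gf_uminus gf_mult gf_divide gf_power gf_of_nat

lemma gf_dvd_mono:
  assumes "m dvd n" shows "gf m \<subseteq> (gf n :: 'b::field_prime_char set)"
proof
  fix x :: 'b assume x: "x \<in> gf m"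
  from assms obtain k where n: "n = m * k" by (auto elim: dvdE)
  have "x ^ (CHAR('b) ^ (m * k)) = x"
  proof (induction k)
    case (Suc k)
    have "x ^ (CHAR('b) ^ (m * Suc k)) = (x ^ (CHAR('b) ^ m)) ^ (CHAR('b) ^ (m * k))"
      by (simp add: power_add flip: power_mult)
    thus ?case using x Suc by (simp add: gf_iff)
  qed auto
  thus "x \<in> gf n" by (simp add: gf_iff n)
qed

text \<open>The polynomial splits into linear factors, and a factor occurring twice would produce a
  common root with the derivative.\<close>

lemma card_roots_separable:
  fixes f :: "'b::alg_closed_field poly"
  assumes f0: "f \<noteq> 0" and "\<And>x. poly f x = 0 \<Longrightarrow> poly (pderiv f) x \<noteq> 0"
  shows "card {x. poly f x = 0} = degree f"
proof -
  obtain A where A: "size A = degree f" "f = smult (lead_coeff f) (\<Prod>x\<in>#A. [:-x, 1:])"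
    using alg_closed_imp_factorization[OF f0] by blast
  have "count A x \<le> 1" for x
  proof (rule ccontr)
    assume "\<not> count A x \<le> 1"
    hence "{#x, x#} \<subseteq># A" by (simp add: subseteq_mset_def)
    then obtain B where B: "A = {#x, x#} + B" by (metis subset_mset.le_iff_add)
    have "\<exists>h. f = [:-x,1:] * ([:-x,1:] * h)"
      by (subst A(2)) (simp only: B image_mset_union image_mset_add_mset prod_mset.union prod_mset.add_mset image_mset_empty
           prod_mset.empty mult_smult_left mult_smult_right mult_1_right,
          metis mult.assoc mult_smult_right)
    then obtain h where h: "f = [:-x,1:] * ([:-x,1:] * h)" by blast
    have "poly f x = 0" "poly (pderiv f) x = 0" unfolding h by (simp_all only: pderiv_mult poly_add poly_mult) simp_all
    thus False using assms by blast
  qed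
  hence "\<And>x. x \<in># A \<Longrightarrow> count A x = 1"
    by (metis One_nat_def Suc_leI antisym count_greater_zero_iff)
  hence "size A = card (set_mset A)"
    by (simp add: size_multiset_overloaded_eq)
  moreover have "{x. poly f x = 0} = set_mset A"
    using f0 by (subst A(2)) (auto simp: poly_prod_mset)
  ultimately show ?thesis using A(1) by simp
qed

lemma CHAR_ge_2: "CHAR('b::field_prime_char) \<ge> 2"
  using prime_ge_2_nat CHAR_prime by blast

text \<open>With q = \<open>CHAR('b) ^ m\<close>, the set \<open>gf m\<close> consists of the roots
  of X^q - X, whose derivative is the constant -1.\<close>

lemma
  assumes "m > 0"
  shows card_gf: "card (gf m :: 'b::{alg_closed_field,field_prime_char} set) = CHAR('b) ^ m"
    and finite_gf: "finite (gf m :: 'b set)"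
proof -
  define q where "q = CHAR('b) ^ m"
  define f :: "'b poly" where "f = monom 1 q + monom (- 1) 1"
  have q: "q > 1" unfolding q_def using assms CHAR_ge_2[where 'b='b]
    by (metis One_nat_def Suc_1 Suc_le_lessD one_less_power)
  have qz: "of_nat q = (0 :: 'b)" using assms by (simp add: q_def)
  have deg: "degree f = q" unfolding f_def
    using q by (subst degree_add_eq_left) (auto simp: degree_monom_eq)
  have "pderiv f = - 1" by (simp add: f_def pderiv_add pderiv_monom qz one_pCons monom_0)
  hence 1: "card {x. poly f x = 0} = q" using card_roots_separable[of f] deg q by fastforce
  have 2: "{x. poly f x = 0} = gf m" by (auto simp: f_def gf_def q_def poly_monom)
  show "card (gf m :: 'b set) = CHAR('b) ^ m" using 1 2 q_def by simp
  show "finite (gf m :: 'b set)" using 2 poly_roots_finite[of f] deg q by (metis degree_0 not_one_less_zero)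
qed

section \<open>The absolute trace and additive characters\<close>

lemma abs_tr_add: "abs_tr m (x + y) = abs_tr m x + abs_tr m y"
  by (simp add: abs_tr_def frob_add sum.distrib)

lemma abs_tr_0 [simp]: "abs_tr m 0 = 0"
  by (simp add: abs_tr_def power_0_left)

lemma abs_tr_diff: "abs_tr m (x - y) = abs_tr m x - abs_tr m y"
  by (simp add: abs_tr_def frob_diff sum_subtractf)

text \<open>Frobenius shifts the sum by one term, so the difference telescopes. Holding for every
  \<open>x\<close>, the identity not only places traces in the prime field but also shows later that
  roots of an Artin-Schreier equation lie in \<open>gf m\<close>.\<close>

lemma abs_tr_frob: "abs_tr m x ^ CHAR('b) - abs_tr m x = x ^ (CHAR('b) ^ m) - (x :: 'b::field_prime_char)"
proof -
  have "abs_tr m x ^ CHAR('b) = (\<Sum>i<m. x ^ (CHAR('b) ^ Suc i))"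
    unfolding abs_tr_def by (subst freshmans_dream_sum) (auto simp: mult.commute simp flip: power_mult)
  also have "\<dots> = (\<Sum>i<Suc m. x ^ (CHAR('b) ^ i)) - x" by (subst sum.lessThan_Suc_shift) simp
  finally show ?thesis by (simp add: abs_tr_def)
qed

lemma abs_tr_in_gf1: "x \<in> gf m \<Longrightarrow> abs_tr m x \<in> gf 1"
  using abs_tr_frob[of m x] by (simp add: gf_iff)

lemma gf1_eq: "(gf 1 :: 'b::{alg_closed_field,field_prime_char} set) = of_nat ` {..<CHAR('b)}"
proof -
  have "inj_on (of_nat :: nat \<Rightarrow> 'b) {..<CHAR('b)}"
    by (auto simp: inj_on_def of_nat_eq_iff_cong_CHAR cong_less_modulus_unique_nat)
  hence "card (of_nat ` {..<CHAR('b)} :: 'b set) = CHAR('b)" by (simp add: card_image)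
  thus ?thesis
    by (intro card_subset_eq[symmetric] finite_gf) (auto simp: card_gf gf_of_nat)
qed

text \<open>Only meaningful on the prime field, where the choice of \<open>c\<close> is immaterial modulo the characteristic.\<close>
definition chi :: "'b::field_prime_char \<Rightarrow> complex" where
  "chi t = cis (2 * pi * real (SOME c. of_nat c = t) / real CHAR('b))"

lemma chi_of_nat: "chi (of_nat c :: 'b::field_prime_char) = cis (2 * pi * real c / real CHAR('b))"
proof -
  define d where "d = (SOME d. of_nat d = (of_nat c :: 'b))"
  have "of_nat d = (of_nat c :: 'b)" unfolding d_def by (rule someI) simp
  hence "[int d = int c] (mod int CHAR('b))" by (simp add: of_nat_eq_iff_cong_CHAR cong_int_iff)
  then obtain k where k: "int c = int d + int CHAR('b) * k" using cong_iff_lin by blast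
  have "real c = real d + real CHAR('b) * of_int k" using k by (metis of_int_add of_int_mult of_int_of_nat_eq)
  hence "2 * pi * real c / real CHAR('b) = 2 * pi * real d / real CHAR('b) + 2 * pi * of_int k"
    by (simp add: field_simps)
  hence "cis (2 * pi * real c / real CHAR('b)) = cis (2 * pi * real d / real CHAR('b)) * cis (2 * pi * of_int k)"
    by (simp only: cis_mult)
  thus ?thesis by (simp add: chi_def d_def cis_multiple_2pi)
qed

lemma norm_chi [simp]: "norm (chi t) = 1"
  by (simp add: chi_def)

lemma chi_0 [simp]: "chi 0 = 1"
  using chi_of_nat[of 0] by simp

lemma chi_add:
  fixes s t :: "'b::{alg_closed_field,field_prime_char}"
  assumes "s \<in> gf 1" "t \<in> gf 1" shows "chi (s + t) = chi s * chi t"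
proof -
  obtain c d where "s = of_nat c" "t = of_nat d" using assms unfolding gf1_eq by blast
  thus ?thesis using chi_of_nat[of "c + d", where 'b='b]
    by (simp add: chi_of_nat cis_mult add_divide_distrib distrib_left)
qed

lemma chi_ne_1:
  fixes t :: "'b::{alg_closed_field,field_prime_char}"
  assumes "t \<in> gf 1" "t \<noteq> 0" shows "chi t \<noteq> 1"
proof
  assume chi1: "chi t = 1"
  obtain c where c: "t = of_nat c" "c < CHAR('b)" using assms(1) unfolding gf1_eq by blast
  with assms(2) have c0: "c > 0" by (cases c) auto
  have "cos (2 * pi * real c / real CHAR('b)) = 1"
    using chi1 c(1) by (simp add: chi_of_nat complex_eq_iff)
  then obtain k :: int where "2 * pi * real c / real CHAR('b) = of_int k * 2 * pi"
    by (auto simp: cos_one_2pi_int)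
  hence "real c = of_int k * real CHAR('b)" by (simp add: field_simps)
  hence "int c = k * int CHAR('b)" by (metis of_int_eq_iff of_int_mult of_int_of_nat_eq)
  hence "int CHAR('b) dvd int c" by simp
  thus False using c0 c(2) by (simp add: nat_dvd_not_less)
qed

definition psi :: "nat \<Rightarrow> 'b::field_prime_char \<Rightarrow> complex" where
  "psi m x = chi (abs_tr m x)"

lemma norm_psi [simp]: "norm (psi m x) = 1" by (simp add: psi_def)
lemma psi_0 [simp]: "psi m 0 = 1" by (simp add: psi_def)

lemma psi_add:
  fixes x y :: "'b::{alg_closed_field,field_prime_char}"
  shows "x \<in> gf m \<Longrightarrow> y \<in> gf m \<Longrightarrow> psi m (x + y) = psi m x * psi m y"
  unfolding psi_def abs_tr_add by (rule chi_add) (rule abs_tr_in_gf1, assumption)+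

text \<open>As a polynomial the trace is nonzero, its linear coefficient being 1, and its degree is
  smaller than the number of elements of \<open>gf d\<close>.\<close>

lemma ex_abs_tr_nonzero:
  assumes "d > 0" shows "\<exists>a\<in>gf d. abs_tr d a \<noteq> (0::'b::{alg_closed_field,field_prime_char})"
proof (rule ccontr)
  assume "\<not> ?thesis"
  hence z: "\<And>a. a \<in> gf d \<Longrightarrow> abs_tr d a = (0::'b)" by blast
  define f :: "'b poly" where "f = (\<Sum>i<d. monom 1 (CHAR('b) ^ i))"
  have p2: "CHAR('b) \<ge> 2" by (rule CHAR_ge_2)
  have pf: "poly f a = abs_tr d a" for a by (simp add: f_def abs_tr_def poly_sum poly_monom)
  have "coeff f 1 = (\<Sum>i<d. if i = 0 then 1 else 0)" unfolding f_def coeff_sum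
    using p2 by (intro sum.cong) auto
  also have "\<dots> = 1" using assms by (simp add: sum.delta)
  finally have f0: "f \<noteq> 0" by auto
  have "degree f \<le> CHAR('b) ^ (d - 1)" unfolding f_def
    by (intro degree_sum_le) (use p2 in \<open>auto simp: degree_monom_eq intro!: power_increasing\<close>)
  also have "\<dots> < CHAR('b) ^ d" using assms p2 by (intro power_strict_increasing) auto
  also have "\<dots> = card (gf d :: 'b set)" using assms by (simp add: card_gf)
  also have "\<dots> \<le> card {x. poly f x = 0}"
    using z pf f0 by (intro card_mono poly_roots_finite) auto
  also have "\<dots> \<le> degree f" by (rule card_poly_roots_bound[OF f0])
  finally show False by simp
qed

section \<open>Relative traces and orthogonality of characters\<close>

definition rel_tr :: "nat \<Rightarrow> nat \<Rightarrow> 'b::field_prime_char \<Rightarrow> 'b" where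
  "rel_tr d l z = (\<Sum>i<l. z ^ (CHAR('b) ^ (d * i)))"

text \<open>The \<open>d\<close>-th power of Frobenius permutes the summands cyclically, since the
  \<open>l\<close>-th one would again be \<open>z\<close>.\<close>

lemma rel_tr_in_gf:
  assumes "z \<in> gf (d * l)" shows "rel_tr d l z \<in> gf d"
proof -
  have "rel_tr d l z ^ (CHAR('a) ^ d) = (\<Sum>i<l. z ^ (CHAR('a) ^ (d * Suc i)))"
    unfolding rel_tr_def frob_sum by (simp add: power_add mult.commute flip: power_mult)
  also have "\<dots> = (\<Sum>i<Suc l. z ^ (CHAR('a) ^ (d * i))) - z" by (subst sum.lessThan_Suc_shift) simp
  also have "\<dots> = rel_tr d l z" using assms by (simp add: rel_tr_def gf_iff)
  finally show ?thesis by (simp add: gf_iff)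
qed

text \<open>Transitivity of the trace: an exponent below \<open>d * l\<close> splits as
  \<open>d * i + j\<close>, and the part \<open>d * i\<close> of Frobenius fixes
  \<open>a\<close>.\<close>

lemma abs_tr_rel_tr:
  assumes "a \<in> gf d" shows "abs_tr (d * l) (a * z) = abs_tr d (a * rel_tr d l (z::'b::field_prime_char))"
proof -
  have a: "a ^ (CHAR('b) ^ (d * i)) = a" for i
    using gf_dvd_mono[of d "d * i"] assms by (auto simp: gf_iff)
  have "abs_tr (d * l) (a * z) = (\<Sum>i<l. \<Sum>j=i*d..<i*d+d. (a * z) ^ (CHAR('b) ^ j))"
    unfolding abs_tr_def by (subst sum.nat_group) (simp add: mult.commute)
  also have "\<dots> = (\<Sum>i<l. \<Sum>j<d. (a * z) ^ (CHAR('b) ^ (d * i + j)))"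
  proof (rule sum.cong[OF refl])
    fix i show "(\<Sum>j=i*d..<i*d+d. (a * z) ^ (CHAR('b) ^ j)) = (\<Sum>j<d. (a * z) ^ (CHAR('b) ^ (d * i + j)))"
      by (rule sum.reindex_bij_witness[of _ "\<lambda>j. d * i + j" "\<lambda>j. j - d * i"]) (auto simp: mult.commute)
  qed
  also have "\<dots> = (\<Sum>j<d. \<Sum>i<l. (a * z) ^ (CHAR('b) ^ (d * i + j)))" by (rule sum.swap)
  also have "\<dots> = (\<Sum>j<d. (a * rel_tr d l z) ^ (CHAR('b) ^ j))"
    by (simp add: rel_tr_def sum_distrib_left frob_sum power_add power_mult power_mult_distrib a[unfolded power_mult])
  finally show ?thesis by (simp add: abs_tr_def)
qed

text \<open>Translating the summation by \<open>z\<close> multiplies the sum by \<open>f z\<close>,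
  which is not 1.\<close>

lemma sum_character_eq_0:
  fixes f :: "'b::ab_group_add \<Rightarrow> complex"
  assumes "finite G" "\<And>x y. x \<in> G \<Longrightarrow> y \<in> G \<Longrightarrow> x - y \<in> G"
    and "\<And>x y. x \<in> G \<Longrightarrow> y \<in> G \<Longrightarrow> x + y \<in> G"
    and "\<And>x y. x \<in> G \<Longrightarrow> y \<in> G \<Longrightarrow> f (x + y) = f x * f y"
    and "z \<in> G" "f z \<noteq> 1"
  shows "(\<Sum>x\<in>G. f x) = 0"
proof -
  have "(\<Sum>x\<in>G. f x) = (\<Sum>x\<in>G. f (x + z))"
    by (rule sum.reindex_bij_witness[of _ "\<lambda>x. x + z" "\<lambda>x. x - z"]) (use assms in auto)
  also have "\<dots> = f z * (\<Sum>x\<in>G. f x)" using assms by (simp add: sum_distrib_left mult.commute)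
  finally have "(1 - f z) * (\<Sum>x\<in>G. f x) = 0" by (simp add: algebra_simps)
  thus ?thesis using assms(6) by simp
qed

text \<open>This is the detector for trace conditions. By transitivity the summands are values of a
  character of \<open>gf d\<close> that depends only on the relative trace of \<open>z\<close>, and
  it is nontrivial when that trace is nonzero.\<close>

lemma sum_psi_subfield:
  fixes z :: "'b::{alg_closed_field,field_prime_char}"
  assumes "d > 0" "z \<in> gf (d * l)"
  shows "(\<Sum>a\<in>gf d. psi (d * l) (a * z)) = (if rel_tr d l z = 0 then of_nat (CHAR('b) ^ d) else 0)"
proof -
  have eq: "psi (d * l) (a * z) = psi d (a * rel_tr d l z)" if "a \<in> gf d" for a
    using that by (simp add: psi_def abs_tr_rel_tr)
  have R: "rel_tr d l z \<in> gf d" using assms(2) by (rule rel_tr_in_gf)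
  show ?thesis
  proof (cases "rel_tr d l z = 0")
    case True thus ?thesis using eq assms(1) by (simp add: card_gf)
  next
    case False
    obtain c where c: "c \<in> gf d" "abs_tr d c \<noteq> (0::'b)" using ex_abs_tr_nonzero[OF assms(1)] by blast
    have "(\<Sum>a\<in>gf d. psi d (a * rel_tr d l z)) = 0"
    proof (rule sum_character_eq_0[where z = "c / rel_tr d l z"])
      show "psi d (c / rel_tr d l z * rel_tr d l z) \<noteq> 1"
        using False chi_ne_1[OF abs_tr_in_gf1[OF c(1)] c(2)] by (simp add: psi_def)
    qed (use R c assms(1) in \<open>auto simp: finite_gf distrib_right intro!: gf_closed psi_add\<close>)
    thus ?thesis using eq False by simp
  qed
qed

lemma sum_psi:
  fixes z :: "'b::{alg_closed_field,field_prime_char}"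
  assumes "m > 0" "z \<in> gf m"
  shows "(\<Sum>a\<in>gf m. psi m (a * z)) = (if z = 0 then of_nat (CHAR('b) ^ m) else 0)"
  using sum_psi_subfield[of m z 1] assms by (simp add: rel_tr_def)

subsection \<open>Kloosterman sums in quadratic extensions\<close>

definition kloosterman :: "nat \<Rightarrow> 'b::field_prime_char \<Rightarrow> 'b \<Rightarrow> complex" where
  "kloosterman m a b = (\<Sum>x\<in>gf m - {0}. psi m (a * x + b / x))"

text \<open>The polynomial \<open>X\<^sup>2 - s X + t\<close> has either its roots in the field, or conjugate roots in the
  quadratic extension.\<close>

lemma card_pairs_sum_prod:
  fixes s t :: "'b::{alg_closed_field,field_prime_char}"
  assumes m: "m > 0" and s: "s \<in> gf m" and t: "t \<in> gf m" "t \<noteq> 0"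
  defines "\<phi> \<equiv> \<lambda>z::'b. z ^ (CHAR('b) ^ m)"
  shows "card {v \<in> (gf m - {0}) \<times> (gf m - {0}). (fst v + snd v, fst v * snd v) = (s, t)}
       + card {z \<in> gf (2*m) - {0}. (z + \<phi> z, z * \<phi> z) = (s, t)} = 2"
proof -
  obtain u where "poly [:t, -s, 1:] u = 0"
    using alg_closed_imp_poly_has_root[of "[:t, -s, 1:]"] by auto
  define v where "v = s - u"
  have uv: "u + v = s" "u * v = t"
    using \<open>poly [:t, -s, 1:] u = 0\<close> by (auto simp: v_def algebra_simps)
  have nz: "u \<noteq> 0" "v \<noteq> 0" using uv t by auto
  have roots: "x + y = s \<and> x * y = t \<longleftrightarrow> x = u \<and> y = v \<or> x = v \<and> y = u" for x y
  proof
    assume xy: "x + y = s \<and> x * y = t"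
    have "(x - u) * (x - v) = x * x - x * (u + v) + u * v" by (simp add: algebra_simps)
    also have "\<dots> = 0" using xy unfolding uv by (auto simp: algebra_simps)
    finally have "x = u \<or> x = v" by simp
    thus "x = u \<and> y = v \<or> x = v \<and> y = u" using xy uv by (auto simp: algebra_simps)
  qed (use uv in \<open>auto simp: algebra_simps\<close>)
  have \<phi>2: "z \<in> gf (2*m) \<longleftrightarrow> \<phi> (\<phi> z) = z" for z
    by (simp add: gf_iff \<phi>_def mult_2 power_add flip: power_mult)
  have \<phi>1: "z \<in> gf m \<longleftrightarrow> \<phi> z = z" for z
    by (simp add: gf_iff \<phi>_def)
  have "\<phi> u + \<phi> v = \<phi> s" "\<phi> u * \<phi> v = \<phi> t"
    unfolding uv[symmetric] by (simp_all add: \<phi>_def frob_add power_mult_distrib)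
  hence "\<phi> u + \<phi> v = s \<and> \<phi> u * \<phi> v = t" using s t \<phi>1 by simp
  hence cases: "\<phi> u = u \<and> \<phi> v = v \<or> \<phi> u = v \<and> \<phi> v = u" unfolding roots by auto
  have A: "{v \<in> (gf m - {0}) \<times> (gf m - {0}). (fst v + snd v, fst v * snd v) = (s, t)}
         = (if \<phi> u = u \<and> \<phi> v = v then {(u, v), (v, u)} else {})"
    using roots nz \<phi>1 by (auto split: if_splits)
  have B: "{z \<in> gf (2*m) - {0}. (z + \<phi> z, z * \<phi> z) = (s, t)}
         = (if \<phi> u = v \<and> \<phi> v = u then {u, v} else {})"
    using roots nz \<phi>2 cases by (auto split: if_splits)
  \<comment> \<open>A double root counts once in each set. Two distinct rational roots give two
    ordered pairs and no \<open>z\<close>; two conjugate roots give two values of \<open>z\<close>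
    and no pair.\<close>
  consider "u = v" "\<phi> u = v" "\<phi> v = u" | "u \<noteq> v" "\<phi> u = u" "\<phi> v = v" | "u \<noteq> v" "\<phi> u = v" "\<phi> v = u"
    using cases by metis
  thus ?thesis unfolding A B by cases simp_all
qed

text \<open>The square and the sum over the extension are both grouped by s and t, the sum and
  product of two elements, respectively trace and norm of one. Each summand equals
  \<open>psi m (a * s + b * s / t)\<close> and each (s, t) occurs twice in total. Summing over s
  then leaves only t = -b/a.\<close>

lemma kloosterman_double:
  fixes a b :: "'b::{alg_closed_field,field_prime_char}"
  assumes m: "m > 0" and a: "a \<in> gf m" "a \<noteq> 0" and b: "b \<in> gf m" "b \<noteq> 0"
  shows "kloosterman (2 * m) a b = 2 * of_nat (CHAR('b) ^ m) - (kloosterman m a b)\<^sup>2"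
proof -
  define F where "F = (gf m :: 'b set)"
  define A where "A = (F - {0}) \<times> (F - {0})"
  define B where "B = gf (2*m) - {0::'b}"
  define T where "T = F \<times> (F - {0})"
  define \<phi> where "\<phi> = (\<lambda>z::'b. z ^ (CHAR('b) ^ m))"
  define g where "g = (\<lambda>(s, t). psi m (a * s + b * s / t))"
  define fA where "fA = (\<lambda>v::'b\<times>'b. (fst v + snd v, fst v * snd v))"
  define fB where "fB = (\<lambda>z. (z + \<phi> z, z * \<phi> z))"
  have fin: "finite F" "finite A" "finite B" "finite T"
    using m by (auto simp: F_def A_def B_def T_def finite_gf)
  have "\<phi> (\<phi> z) = z" if "z \<in> gf (2*m)" for z
    using that by (simp add: gf_iff \<phi>_def mult_2 power_add flip: power_mult)
  hence fB_T: "fB ` B \<subseteq> T"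
    by (auto simp: fB_def T_def F_def B_def gf_iff frob_add power_mult_distrib \<phi>_def add.commute mult.commute)
  have fA_T: "fA ` A \<subseteq> T"
    by (auto simp: fA_def A_def T_def F_def intro!: gf_closed)
  have "(kloosterman m a b)\<^sup>2 = (\<Sum>x\<in>F-{0}. \<Sum>y\<in>F-{0}. psi m (a * x + b / x) * psi m (a * y + b / y))"
    by (simp add: kloosterman_def power2_eq_square sum_product F_def)
  also have "\<dots> = (\<Sum>v\<in>A. psi m (a * fst v + b / fst v) * psi m (a * snd v + b / snd v))"
    by (simp add: A_def sum.cartesian_product case_prod_beta)
  also have "\<dots> = (\<Sum>v\<in>A. g (fA v))"
  proof (intro sum.cong refl)
    fix v assume v: "v \<in> A"
    hence "psi m (a * fst v + b / fst v) * psi m (a * snd v + b / snd v)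
         = psi m ((a * fst v + b / fst v) + (a * snd v + b / snd v))"
      using a b by (subst psi_add) (auto simp: A_def F_def intro!: gf_closed)
    also have "(a * fst v + b / fst v) + (a * snd v + b / snd v)
         = a * (fst v + snd v) + b * (fst v + snd v) / (fst v * snd v)"
      using v by (auto simp: A_def add_divide_distrib distrib_left distrib_right)
    finally show "psi m (a * fst v + b / fst v) * psi m (a * snd v + b / snd v) = g (fA v)"
      by (simp add: g_def fA_def)
  qed
  also have "\<dots> = (\<Sum>t\<in>T. \<Sum>v\<in>{v\<in>A. fA v = t}. g (fA v))"
    by (rule sum.group[symmetric]) (use fin fA_T in auto)
  also have "\<dots> = (\<Sum>t\<in>T. of_nat (card {v\<in>A. fA v = t}) * g t)" by simp
  finally have K1: "(kloosterman m a b)\<^sup>2 = (\<Sum>t\<in>T. of_nat (card {v\<in>A. fA v = t}) * g t)" .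
  have "kloosterman (2 * m) a b = (\<Sum>z\<in>B. g (fB z))"
    unfolding kloosterman_def B_def[symmetric]
  proof (intro sum.cong refl)
    fix z assume z: "z \<in> B"
    have nz: "z \<noteq> 0" "\<phi> z \<noteq> 0" using z by (auto simp: B_def \<phi>_def)
    have ab: "\<phi> a = a" "\<phi> b = b" using a b by (auto simp: gf_iff \<phi>_def)
    have "abs_tr (2 * m) (a * z + b / z) = abs_tr m (rel_tr m 2 (a * z + b / z))"
      using abs_tr_rel_tr[of 1 m 2 "a * z + b / z"] by (simp add: mult.commute)
    also have "rel_tr m 2 (a * z + b / z) = (a * z + b / z) + (\<phi> a * \<phi> z + \<phi> b / \<phi> z)"
      by (simp add: rel_tr_def numeral_2_eq_2 frob_add power_mult_distrib power_divide \<phi>_def)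
    also have "\<dots> = a * (z + \<phi> z) + b * (z + \<phi> z) / (z * \<phi> z)"
      using nz by (simp add: ab field_simps)
    finally show "psi (2 * m) (a * z + b / z) = g (fB z)"
      by (simp add: psi_def g_def fB_def)
  qed
  also have "\<dots> = (\<Sum>t\<in>T. \<Sum>v\<in>{v\<in>B. fB v = t}. g (fB v))"
    by (rule sum.group[symmetric]) (use fin fB_T in auto)
  also have "\<dots> = (\<Sum>t\<in>T. of_nat (card {v\<in>B. fB v = t}) * g t)" by simp
  finally have K2: "kloosterman (2 * m) a b = (\<Sum>t\<in>T. of_nat (card {v\<in>B. fB v = t}) * g t)" .
  have "(kloosterman m a b)\<^sup>2 + kloosterman (2 * m) a b
      = (\<Sum>t\<in>T. of_nat (card {v\<in>A. fA v = t} + card {v\<in>B. fB v = t}) * g t)"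
    unfolding K1 K2 by (simp add: sum.distrib distrib_right)
  also have "\<dots> = (\<Sum>t\<in>T. 2 * g t)"
  proof (intro sum.cong refl)
    fix st assume st: "st \<in> T"
    have "card {v\<in>A. fA v = st} + card {v\<in>B. fB v = st} = 2"
      using card_pairs_sum_prod[OF m, of "fst st" "snd st"] st
      unfolding A_def B_def fA_def fB_def F_def T_def \<phi>_def by force
    thus "of_nat (card {v\<in>A. fA v = st} + card {v\<in>B. fB v = st}) * g st = 2 * g st" by simp
  qed
  also have "\<dots> = 2 * (\<Sum>t\<in>F-{0}. \<Sum>s\<in>F. g (s, t))"
    unfolding T_def by (subst sum.swap) (simp add: sum.cartesian_product sum_distrib_left)
  also have "(\<Sum>t\<in>F-{0}. \<Sum>s\<in>F. g (s, t)) = (\<Sum>t\<in>F-{0}. if t = - b / a then of_nat (CHAR('b) ^ m) else 0)"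
  proof (intro sum.cong refl)
    fix t assume t: "t \<in> F - {0}"
    have "(\<Sum>s\<in>F. g (s, t)) = (\<Sum>s\<in>gf m. psi m (s * (a + b / t)))"
      unfolding g_def F_def by (intro sum.cong refl) (simp add: algebra_simps)
    also have "\<dots> = (if a + b / t = 0 then of_nat (CHAR('b) ^ m) else 0)"
      using t a b m by (intro sum_psi) (auto simp: F_def intro!: gf_closed)
    also have "a + b / t = 0 \<longleftrightarrow> t = - b / a"
      using t a by (auto simp: field_simps add_eq_0_iff)
    finally show "(\<Sum>s\<in>F. g (s, t)) = (if t = - b / a then of_nat (CHAR('b) ^ m) else 0)" .
  qed
  also have "\<dots> = of_nat (CHAR('b) ^ m)"
    using a b fin by (simp add: sum.delta F_def gf_closed)
  finally show ?thesis by (simp add: algebra_simps)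
qed

subsection \<open>Stepanov's method\<close>

text \<open>Gaussian elimination, by induction on the set of equations: \<open>M'\<close> is the
  system left after equation \<open>j\<close> has been used to eliminate the unknown
  \<open>i0\<close>.\<close>

lemma ex_nontrivial_solution:
  fixes M :: "'i \<Rightarrow> 'j \<Rightarrow> 'b::field"
  assumes "finite J" "finite I" "card J < card I"
  shows "\<exists>u. (\<exists>i\<in>I. u i \<noteq> 0) \<and> (\<forall>j\<in>J. (\<Sum>i\<in>I. M i j * u i) = 0)"
  using assms
proof (induction J arbitrary: I M rule: finite_induct)
  case empty
  hence "I \<noteq> {}" by auto
  thus ?case by (intro exI[of _ "\<lambda>_. 1"]) auto
next
  case (insert j J)
  show ?case
  proof (cases "\<forall>i\<in>I. M i j = 0")
    case True
    obtain u where "\<exists>i\<in>I. u i \<noteq> 0" "\<forall>j\<in>J. (\<Sum>i\<in>I. M i j * u i) = 0"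
      using insert.IH[of I M] insert.prems insert.hyps by auto
    thus ?thesis using True by (intro exI[of _ u]) auto
  next
    case False
    then obtain i0 where i0: "i0 \<in> I" "M i0 j \<noteq> 0" by blast
    define I' where "I' = I - {i0}"
    have I': "finite I'" "i0 \<notin> I'" "I = insert i0 I'" using i0 insert.prems by (auto simp: I'_def)
    define M' where "M' = (\<lambda>i k. M i k - M i j / M i0 j * M i0 k)"
    have "card J < card I'" using insert I' by simp
    then obtain u where u: "\<exists>i\<in>I'. u i \<noteq> 0" "\<forall>k\<in>J. (\<Sum>i\<in>I'. M' i k * u i) = 0"
      using insert.IH[of I' M'] I'(1) by auto
    define c where "c = - (\<Sum>i\<in>I'. M i j * u i) / M i0 j"
    have sum_eq: "(\<Sum>i\<in>I. M i k * (u(i0 := c)) i) = M i0 k * c + (\<Sum>i\<in>I'. M i k * u i)" for k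
      unfolding I'(3) using I' by (auto intro!: sum.cong)
    have "(\<Sum>i\<in>I. M i k * (u(i0 := c)) i) = 0" if "k \<in> insert j J" for k
    proof (cases "k = j")
      case True thus ?thesis unfolding sum_eq using i0 by (simp add: c_def)
    next
      case False
      hence "0 = (\<Sum>i\<in>I'. M' i k * u i)" using u(2) that by auto
      also have "\<dots> = (\<Sum>i\<in>I'. M i k * u i) - (\<Sum>i\<in>I'. M i j * u i) / M i0 j * M i0 k"
        by (simp add: M'_def algebra_simps sum_subtractf sum_distrib_left sum_divide_distrib)
      finally show ?thesis unfolding sum_eq by (simp add: c_def algebra_simps)
    qed
    moreover have "\<exists>i\<in>I. (u(i0 := c)) i \<noteq> 0" using u(1) I' by auto
    ultimately show ?thesis by blast
  qed
qed

text \<open>With \<open>w = x y\<close> the equation \<open>y\<^sup>p - y = a x + b/x - \<theta>\<close> becomes the polynomial equation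
  \<open>on_curve\<close> below, and \<open>x\<close>, \<open>w\<close> have poles of order \<open>p\<close> and \<open>p + 1\<close> at the only place at infinity.
  Hence \<open>x\<^sup>k w\<^sup>i\<close> with \<open>i < p\<close> has pole order \<open>n = p k + (p + 1) i\<close>; it is \<open>wt_mon p n\<close>, as \<open>i = n mod p\<close> and
  \<open>k = n div p - n mod p\<close>. The valid weights are those for which this difference is not truncated.\<close>

definition valid_wt :: "nat \<Rightarrow> nat \<Rightarrow> bool" where
  "valid_wt p n \<longleftrightarrow> n mod p \<le> n div p"

definition wt_mon :: "nat \<Rightarrow> nat \<Rightarrow> 'b::field \<Rightarrow> 'b \<Rightarrow> 'b" where
  "wt_mon p n x w = x ^ (n div p - n mod p) * w ^ (n mod p)"

locale as_curve =
  fixes p :: nat and a b \<theta> :: "'b::field"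
  assumes p: "p \<ge> 2" and a: "a \<noteq> 0"
begin

definition on_curve :: "'b \<Rightarrow> 'b \<Rightarrow> bool" where
  "on_curve x w \<longleftrightarrow> w ^ p = x ^ (p - 1) * w + a * x ^ (p + 1) - \<theta> * x ^ p + b * x ^ (p - 1)"

text \<open>The coefficients are kept as an argument because the later nonvanishing argument needs
  the one at the top weight. They are supported on valid weights, so different weights stand for
  different monomials.\<close>

definition rep :: "nat \<Rightarrow> ('b \<Rightarrow> 'b \<Rightarrow> 'b) \<Rightarrow> (nat \<Rightarrow> 'b) \<Rightarrow> bool" where
  "rep D f c \<longleftrightarrow> (\<forall>n. c n \<noteq> 0 \<longrightarrow> n \<le> D \<and> valid_wt p n) \<and>
     (\<forall>x w. on_curve x w \<longrightarrow> f x w = (\<Sum>n\<le>D. c n * wt_mon p n x w))"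

lemma rep_nonzeroD: "rep D f c \<Longrightarrow> c n \<noteq> 0 \<Longrightarrow> n \<le> D \<and> valid_wt p n"
  unfolding rep_def by blast

lemma rep_evalD: "rep D f c \<Longrightarrow> on_curve x w \<Longrightarrow> f x w = (\<Sum>n\<le>D. c n * wt_mon p n x w)"
  unfolding rep_def by blast

lemma rep_mono: "rep D f c \<Longrightarrow> D \<le> D' \<Longrightarrow> rep D' f c"
  unfolding rep_def
  by (intro conjI allI impI; (force | elim conjE; simp; intro sum.mono_neutral_left; auto))

lemma rep_add: "rep D f c \<Longrightarrow> rep D g d \<Longrightarrow> rep D (\<lambda>x w. f x w + g x w) (\<lambda>n. c n + d n)"
  unfolding rep_def by (auto simp: sum.distrib distrib_right) (metis add_0)+

lemma rep_scale: "rep D f c \<Longrightarrow> rep D (\<lambda>x w. k * f x w) (\<lambda>n. k * c n)"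
  unfolding rep_def by (auto simp: sum_distrib_left mult.assoc)

text \<open>The curve equation replaces \<open>w ^ p\<close> and so lowers the exponent of
  \<open>w\<close>. The term \<open>a * x ^ (p + 1)\<close> has the same weight as
  \<open>w ^ p\<close> and the other three have smaller weight, so the top coefficient is only
  multiplied by \<open>a \<noteq> 0\<close>.\<close>

lemma rep_monomial:
  "\<exists>c. rep (p * K + (p + 1) * I) (\<lambda>x w. x ^ K * w ^ I) c \<and> c (p * K + (p + 1) * I) \<noteq> 0"
proof (induction I arbitrary: K rule: less_induct)
  case (less I)
  define D where "D = p * K + (p + 1) * I"
  show ?case
  proof (cases "I < p")
    case True
    have D': "D = p * (K + I) + I" by (simp add: D_def algebra_simps)
    have D: "D div p = K + I" "D mod p = I" unfolding D' using True by auto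
    have "rep D (\<lambda>x w. x ^ K * w ^ I) (\<lambda>n. if n = D then 1 else 0)"
      unfolding rep_def valid_wt_def wt_mon_def
      by (auto simp: D if_distrib[of "\<lambda>x. x * _"] sum.delta cong: if_cong split: if_splits)
    thus ?thesis unfolding D_def[symmetric] by (intro exI) auto
  next
    case False
    then obtain J where I: "I = p + J" using le_Suc_ex not_less by blast
    obtain p' where p': "p = Suc p'" "p' > 0" using p by (cases p) auto
    define D1 where "D1 = p * (K + p') + (p + 1) * (J + 1)"
    define D3 where "D3 = p * (K + p) + (p + 1) * J"
    define D4 where "D4 = p * (K + p') + (p + 1) * J"
    obtain c1 where c1: "rep D1 (\<lambda>x w. x ^ (K + p') * w ^ (J + 1)) c1"
      using less.IH[of "J + 1" "K + p'"] p' unfolding I D1_def by auto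
    have D2: "p * (K + p + 1) + (p + 1) * J = D" by (simp add: D_def I algebra_simps)
    obtain c2 where c2: "rep D (\<lambda>x w. x ^ (K + p + 1) * w ^ J) c2" "c2 D \<noteq> 0"
      using less.IH[of "J" "K + p + 1"] p' unfolding I D2 by auto
    obtain c3 where c3: "rep D3 (\<lambda>x w. x ^ (K + p) * w ^ J) c3"
      using less.IH[of "J" "K + p"] p' unfolding I D3_def by auto
    obtain c4 where c4: "rep D4 (\<lambda>x w. x ^ (K + p') * w ^ J) c4"
      using less.IH[of "J" "K + p'"] p' unfolding I D4_def by auto
    have lt: "D1 < D" "D3 < D" "D4 < D"
      using p' by (simp_all add: D_def D1_def D3_def D4_def I algebra_simps)
    define c where "c = (\<lambda>n. ((c1 n + a * c2 n) + (-\<theta>) * c3 n) + b * c4 n)"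
    have "rep D (\<lambda>x w. ((x ^ (K + p') * w ^ (J + 1) + a * (x ^ (K + p + 1) * w ^ J))
              + (-\<theta>) * (x ^ (K + p) * w ^ J)) + b * (x ^ (K + p') * w ^ J)) c"
      unfolding c_def using lt
      by (intro rep_add rep_scale c2 rep_mono[OF c1] rep_mono[OF c3] rep_mono[OF c4]) auto
    moreover have "((x ^ (K + p') * w ^ (J + 1) + a * (x ^ (K + p + 1) * w ^ J))
              + (-\<theta>) * (x ^ (K + p) * w ^ J)) + b * (x ^ (K + p') * w ^ J) = x ^ K * w ^ I"
      if "on_curve x w" for x w
    proof -
      have "x ^ K * w ^ I = x ^ K * w ^ J * w ^ p" by (simp add: I power_add)
      also have "w ^ p = x ^ p' * w + a * x ^ (p + 1) - \<theta> * x ^ p + b * x ^ p'"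
        using that unfolding on_curve_def by (simp add: p')
      finally show ?thesis by (simp add: algebra_simps power_add)
    qed
    ultimately have "rep D (\<lambda>x w. x ^ K * w ^ I) c" by (simp add: rep_def)
    moreover have "c1 D = 0" "c3 D = 0" "c4 D = 0"
      using c1 c3 c4 lt unfolding rep_def by (meson leD)+
    hence "c D \<noteq> 0" using c2 a by (simp add: c_def)
    ultimately show ?thesis unfolding D_def by blast
  qed
qed

lemma rep_product:
  assumes "valid_wt p i" "valid_wt p j"
  shows "\<exists>c. rep (s * i + j) (\<lambda>x w. wt_mon p i x w ^ s * wt_mon p j x w) c \<and> c (s * i + j) \<noteq> 0"
proof -
  have wt: "p * (n div p - n mod p) + (p + 1) * (n mod p) = n" if "valid_wt p n" for n
  proof -
    have "p * (n div p - n mod p) + (p + 1) * (n mod p)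
        = p * ((n div p - n mod p) + n mod p) + n mod p" by (simp only: algebra_simps mult_1)
    also have "(n div p - n mod p) + n mod p = n div p" using that by (simp add: valid_wt_def)
    finally show ?thesis by simp
  qed
  define K where "K = s * (i div p - i mod p) + (j div p - j mod p)"
  define I where "I = s * (i mod p) + j mod p"
  have "p * K + (p + 1) * I = s * (p * (i div p - i mod p) + (p + 1) * (i mod p))
           + (p * (j div p - j mod p) + (p + 1) * (j mod p))"
    unfolding K_def I_def by (simp only: distrib_left distrib_right ac_simps)
  also have "\<dots> = s * i + j" using assms by (simp only: wt)
  finally have wt_eq: "p * K + (p + 1) * I = s * i + j" .
  have mon_eq: "wt_mon p i x w ^ s * wt_mon p j x w = x ^ K * w ^ I" for x w
    by (simp add: wt_mon_def K_def I_def power_add power_mult_distrib mult.commute flip: power_mult)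
  show ?thesis using rep_monomial[of K I] unfolding wt_eq mon_eq .
qed

text \<open>The unknowns are the coefficients of an auxiliary function \<open>\<Sum>\<nu>\<^sub>j\<^sup>s e\<^sub>j\<close> required to vanish
  identically on the curve. On the rational points, where \<open>e\<^sub>j\<close> coincides with its \<open>s\<^sup>2\<close>-th power,
  that function is the \<open>s\<close>-th power of \<open>\<Sum>\<nu>\<^sub>j e\<^sub>j\<^sup>s\<close>, which is not identically zero because its terms
  have distinct weights.\<close>

lemma ex_vanishing_function:
  assumes s: "(p\<^sup>2 + 3)\<^sup>2 \<le> s"
    and frob: "\<And>(f :: nat \<times> nat \<Rightarrow> 'b) A. sum f A ^ s = (\<Sum>i\<in>A. f i ^ s)"
    and root: "\<And>y :: 'b. \<exists>v. v ^ s = y"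
  shows "\<exists>d. (\<forall>n. d n \<noteq> 0 \<longrightarrow> valid_wt p n) \<and> (\<exists>n\<le>s\<^sup>2 + (2 * p\<^sup>2 + 4) * s. d n \<noteq> 0) \<and>
    (\<forall>x w. on_curve x w \<longrightarrow> x ^ s\<^sup>2 = x \<longrightarrow> w ^ s\<^sup>2 = w \<longrightarrow>
        (\<Sum>n\<le>s\<^sup>2 + (2 * p\<^sup>2 + 4) * s. d n * wt_mon p n x w) = 0)"
proof -
  define G where "G = p\<^sup>2"
  define D where "D = s\<^sup>2 + (2 * p\<^sup>2 + 4) * s"
  have sG: "(G + 3)\<^sup>2 \<le> s" using s by (simp add: G_def)
  hence sG': "G < s" by (simp add: power2_eq_square algebra_simps)
  hence s0: "s > 0" by simp
  define V where "V = (\<lambda>d. {n. n \<le> d \<and> valid_wt p n})"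
  have finV: "finite (V d)" for d unfolding V_def by (rule finite_subset[of _ "{..d}"]) auto
  \<comment> \<open>From p^2 on every weight is valid, so at most \<open>G\<close> weights are
    lost.\<close>
  have cardV: "card (V d) \<ge> d + 1 - G" for d
  proof -
    have "{G..d} \<subseteq> V d"
    proof
      fix n assume n: "n \<in> {G..d}"
      have "p \<le> n div p" using n p by (simp add: G_def power2_eq_square less_eq_div_iff_mult_less_eq)
      moreover have "n mod p < p" using p by simp
      ultimately show "n \<in> V d" using n by (simp add: V_def valid_wt_def)
    qed
    from card_mono[OF finV this] show ?thesis by simp
  qed
  \<comment> \<open>Since \<open>l < s\<close>, the number \<open>s * j + i\<close> determines the
    pair (i, j). The choice of \<open>m\<close> gives at least \<open>(s - G) * (s + G + 4)\<close>
    unknowns against \<open>s\<^sup>2 + 2 * G + 4\<close> equations; for this count to suffice,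
    \<open>4 * s\<close> must exceed \<open>G\<^sup>2 + 6 * G + 4\<close>, which follows from
    \<open>sG\<close>.\<close>
  define l where "l = s - 1"
  define m where "m = s + 2 * G + 3"
  define I where "I = V l \<times> V m"
  define J where "J = {..s * l + m}"
  have finI: "finite I" by (simp add: I_def finV)
  have "card J < (s - G) * (s + G + 4)"
  proof -
    obtain k where k: "s = G + k" using sG' less_imp_add_positive by blast
    have "card J = s * (s - 1) + m + 1" by (simp add: J_def l_def)
    also have "s * (s - 1) + s = s * s" using s0 by (cases s) auto
    hence "s * (s - 1) + m + 1 = s * s + 2 * G + 4" by (simp add: m_def)
    also have "\<dots> < (s - G) * (s + G + 4)"
      using sG unfolding k by (simp add: algebra_simps power2_eq_square)
    finally show ?thesis .
  qed
  also have "\<dots> = (l + 1 - G) * (m + 1 - G)" using s0 by (simp add: l_def m_def)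
  also have "\<dots> \<le> card I" unfolding I_def card_cartesian_product
    by (intro mult_le_mono cardV)
  finally have card_less: "card J < card I" .
  define r where "r = (\<lambda>i j. SOME c. rep (s * i + j) (\<lambda>x w. wt_mon p i x w ^ s * wt_mon p j x w) c
      \<and> c (s * i + j) \<noteq> 0)"
  have r: "rep (s * i + j) (\<lambda>x w. wt_mon p i x w ^ s * wt_mon p j x w) (r i j) \<and> r i j (s * i + j) \<noteq> 0"
    if "valid_wt p i" "valid_wt p j" for i j
    using someI_ex[OF rep_product[OF that, of s]] unfolding r_def .
  have rI: "rep (s * l + m) (\<lambda>x w. wt_mon p i x w ^ s * wt_mon p j x w) (r i j)"
    if "(i, j) \<in> I" for i j
  proof (rule rep_mono)
    show "rep (s * i + j) (\<lambda>x w. wt_mon p i x w ^ s * wt_mon p j x w) (r i j)"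
      using that r by (simp add: I_def V_def)
    show "s * i + j \<le> s * l + m" using that by (intro add_mono mult_le_mono) (auto simp: I_def V_def)
  qed
  have lmD: "s * m + l \<le> D" by (simp add: D_def m_def l_def G_def algebra_simps power2_eq_square)
  have rI': "rep D (\<lambda>x w. wt_mon p j x w ^ s * wt_mon p i x w) (r j i)"
    if "(i, j) \<in> I" for i j
  proof (rule rep_mono)
    show "rep (s * j + i) (\<lambda>x w. wt_mon p j x w ^ s * wt_mon p i x w) (r j i)"
      using that r by (simp add: I_def V_def)
    have "s * j + i \<le> s * m + l" using that by (intro add_mono mult_le_mono) (auto simp: I_def V_def)
    thus "s * j + i \<le> D" using lmD by simp
  qed
  obtain u where u: "\<exists>t\<in>I. u t \<noteq> 0" "\<forall>n\<in>J. (\<Sum>t\<in>I. r (fst t) (snd t) n * u t) = 0"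
    using ex_nontrivial_solution[of J I "\<lambda>t. r (fst t) (snd t)"] card_less finI by (auto simp: J_def)
  \<comment> \<open>Taking \<open>s\<close>-th roots of the solution yields the coefficients of the
    function expanded by \<open>d\<close>. In it the exponents 1 and \<open>s\<close> of the two
    monomials are exchanged, so that its \<open>s\<close>-th power brings back
    \<open>u\<close>.\<close>
  have "\<forall>t. \<exists>v. v ^ s = u t" using root by blast
  then obtain v where v: "\<And>t. v t ^ s = u t" using choice[of "\<lambda>t v. v ^ s = u t"] by blast
  define d where "d = (\<lambda>n. \<Sum>t\<in>I. v t * r (snd t) (fst t) n)"
  have valid: "valid_wt p n" if dn: "d n \<noteq> 0" for n
  proof -
    obtain t where "t \<in> I" "v t * r (snd t) (fst t) n \<noteq> 0"
      using dn unfolding d_def by (meson sum.not_neutral_contains_not_neutral)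
    thus ?thesis using rep_nonzeroD[OF rI'[of "fst t" "snd t"], of n] by simp
  qed
  have "\<exists>n\<le>D. d n \<noteq> 0"
  proof -
    define f where "f = (\<lambda>t :: nat \<times> nat. s * snd t + fst t)"
    define I' where "I' = {t\<in>I. v t \<noteq> 0}"
    have inj: "inj_on f I"
    proof (rule inj_onI)
      fix t t' assume t: "t \<in> I" "t' \<in> I" "f t = f t'"
      have lt: "fst t < s" "fst t' < s" using t s0 by (auto simp: I_def V_def l_def)
      have "f t mod s = fst t" "f t div s = snd t" "f t' mod s = fst t'" "f t' div s = snd t'"
        using lt s0 by (auto simp: f_def)
      thus "t = t'" using t(3) by (simp add: prod_eq_iff)
    qed
    have "I' \<noteq> {}"
    proof -
      obtain t where "t \<in> I" "u t \<noteq> 0" using u(1) by blast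
      hence "t \<in> I'" using v[of t] s0 by (cases "v t = 0") (auto simp: I'_def power_0_left)
      thus ?thesis by blast
    qed
    moreover have "finite I'" using finI by (simp add: I'_def)
    ultimately have "Max (f ` I') \<in> f ` I'" by simp
    \<comment> \<open>Among the terms with nonzero \<open>v\<close> the largest top weight is
      attained only once, so nothing cancels the coefficient there.\<close>
    then obtain t where t: "t \<in> I'" "Max (f ` I') = f t" by auto
    have max: "f t' \<le> f t" if "t' \<in> I'" for t'
      using that \<open>finite I'\<close> t(2)[symmetric] by simp
    have tI: "t \<in> I" "v t \<noteq> 0" using t(1) by (auto simp: I'_def)
    have "d (f t) = (\<Sum>t'\<in>{t}. v t' * r (snd t') (fst t') (f t))"
      unfolding d_def
    proof (intro sum.mono_neutral_right finI ballI)
      fix t' assume t': "t' \<in> I - {t}"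
      show "v t' * r (snd t') (fst t') (f t) = 0"
      proof (cases "v t' = 0")
        case False
        hence "f t' \<le> f t" "f t' \<noteq> f t" using max[of t'] t' tI inj by (auto simp: I'_def inj_on_def)
        hence "\<not> f t \<le> s * snd t' + fst t'" by (simp add: f_def)
        moreover have "rep (s * snd t' + fst t') (\<lambda>x w. wt_mon p (snd t') x w ^ s * wt_mon p (fst t') x w)
            (r (snd t') (fst t'))" using r[of "snd t'" "fst t'"] t' by (auto simp: I_def V_def)
        ultimately show ?thesis using rep_nonzeroD by force
      qed simp
    qed (use tI in auto)
    moreover have "r (snd t) (fst t) (f t) \<noteq> 0"
      using r[of "snd t" "fst t"] tI by (auto simp: I_def V_def f_def)
    ultimately have "d (f t) \<noteq> 0" using tI by simp
    moreover have "f t \<le> s * m + l" using tI unfolding f_def by (intro add_mono mult_le_mono) (auto simp: I_def V_def)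
    ultimately show ?thesis using lmD by (meson order_trans)
  qed
  moreover have "(\<Sum>n\<le>D. d n * wt_mon p n x w) = 0"
    if curve: "on_curve x w" and rat: "x ^ s\<^sup>2 = x" "w ^ s\<^sup>2 = w" for x w
  proof -
    let ?e = "\<lambda>n. wt_mon p n x w"
    have e: "?e n ^ (s * s) = ?e n" for n
    proof -
      have "?e n ^ (s * s) = (x ^ s\<^sup>2) ^ (n div p - n mod p) * (w ^ s\<^sup>2) ^ (n mod p)"
        by (simp add: wt_mon_def power_mult_distrib mult.commute power2_eq_square flip: power_mult)
      thus ?thesis by (simp add: rat wt_mon_def)
    qed
    have "(\<Sum>n\<le>D. d n * ?e n) = (\<Sum>n\<le>D. \<Sum>t\<in>I. v t * (r (snd t) (fst t) n * ?e n))"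
      by (simp add: d_def sum_distrib_right mult.assoc)
    also have "\<dots> = (\<Sum>t\<in>I. v t * (\<Sum>n\<le>D. r (snd t) (fst t) n * ?e n))"
      by (subst sum.swap) (simp add: sum_distrib_left)
    also have "\<dots> = (\<Sum>t\<in>I. v t * (?e (snd t) ^ s * ?e (fst t)))"
      using rep_evalD[OF rI' curve] by (intro sum.cong refl arg_cong2[where f="(*)"]) simp
    finally have eq: "(\<Sum>n\<le>D. d n * ?e n) = (\<Sum>t\<in>I. v t * (?e (snd t) ^ s * ?e (fst t)))" .
    have "(\<Sum>n\<le>D. d n * ?e n) ^ s = (\<Sum>t\<in>I. u t * (?e (snd t) * ?e (fst t) ^ s))"
      unfolding eq frob by (simp add: power_mult_distrib v e flip: power_mult)
    also have "\<dots> = (\<Sum>t\<in>I. u t * (\<Sum>n\<le>s*l+m. r (fst t) (snd t) n * ?e n))"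
      using rep_evalD[OF rI curve]
      by (intro sum.cong refl arg_cong2[where f="(*)"]) (simp add: mult.commute)
    also have "\<dots> = (\<Sum>n\<le>s*l+m. ?e n * (\<Sum>t\<in>I. r (fst t) (snd t) n * u t))"
      unfolding sum_distrib_left by (subst sum.swap) (simp add: mult_ac)
    also have "\<dots> = 0" using u(2) by (simp add: J_def)
    finally show ?thesis using s0 by simp
  qed
  ultimately show ?thesis using valid unfolding D_def by blast
qed

end

text \<open>Each \<open>x\<close> counted here carries p rational points of the curve. Over such an
  \<open>x\<close> the auxiliary function is a polynomial in \<open>w\<close> of degree below p with
  p roots, so all its coefficients vanish at \<open>x\<close>. One of them is a nonzero polynomial
  in \<open>x\<close> of degree at most \<open>D div p\<close>, which bounds the number of such
  \<open>x\<close>.\<close>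

lemma card_trace_fibre_le:
  fixes a b \<theta> :: "'b::{alg_closed_field,field_prime_char}"
  assumes h: "h > 0" and large: "(CHAR('b)\<^sup>2 + 3)\<^sup>2 \<le> CHAR('b) ^ h"
    and a: "a \<in> gf (2 * h)" "a \<noteq> 0" and b: "b \<in> gf (2 * h)" and \<theta>: "\<theta> \<in> gf (2 * h)"
  shows "CHAR('b) * card {x \<in> gf (2 * h) - {0}. abs_tr (2 * h) (a * x + b / x - \<theta>) = 0}
     \<le> (CHAR('b) ^ h)\<^sup>2 + (2 * CHAR('b)\<^sup>2 + 4) * CHAR('b) ^ h"
proof -
  define p where "p = CHAR('b)"
  define s where "s = p ^ h"
  define m where "m = 2 * h"
  define D where "D = s\<^sup>2 + (2 * p\<^sup>2 + 4) * s"
  define Xs where "Xs = {x \<in> gf m - {0}. abs_tr m (a * x + b / x - \<theta>) = 0}"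
  have p2: "p \<ge> 2" unfolding p_def by (rule CHAR_ge_2)
  interpret as_curve p a b \<theta> by standard (use p2 a in auto)
  have s2: "s\<^sup>2 = CHAR('b) ^ m" by (simp add: s_def p_def m_def mult.commute flip: power_mult)
  have gf_s: "x \<in> gf m \<longleftrightarrow> x ^ s\<^sup>2 = x" for x :: 'b by (simp add: s2 gf_iff)
  have "s > 0" using p2 by (simp add: s_def)
  have large': "(p\<^sup>2 + 3)\<^sup>2 \<le> s" using large by (simp add: s_def p_def)
  have frob_s: "sum f A ^ s = (\<Sum>i\<in>A. f i ^ s)" for f :: "nat \<times> nat \<Rightarrow> 'b" and A
    unfolding s_def p_def by (rule frob_sum)
  obtain d n0 where d: "\<forall>n. d n \<noteq> 0 \<longrightarrow> valid_wt p n" and n0: "n0 \<le> D" "d n0 \<noteq> 0"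
    and vanish: "\<forall>x w. on_curve x w \<longrightarrow> x ^ s\<^sup>2 = x \<longrightarrow> w ^ s\<^sup>2 = w \<longrightarrow>
        (\<Sum>n\<le>D. d n * wt_mon p n x w) = 0"
    using ex_vanishing_function[OF large' frob_s nth_root_exists[OF \<open>s > 0\<close>]]
    unfolding D_def[symmetric] by (elim exE conjE) (rule that)
  \<comment> \<open>The coefficient of \<open>w ^ i\<close> is the one in which the nonzero
    \<open>d n0\<close> occurs.\<close>
  define i where "i = n0 mod p"
  have coeff_0: "(\<Sum>n\<in>{n. n \<le> D \<and> n mod p = i}. d n * x ^ (n div p - i)) = 0" if x: "x \<in> Xs" for x
  proof -
    have xm: "x \<in> gf m" "x \<noteq> 0" "abs_tr m (a * x + b / x - \<theta>) = 0" using x by (auto simp: Xs_def)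
    define f where "f = a * x + b / x - \<theta>"
    have "degree ([:- f, -1:] + monom 1 p) = p"
      using p2 by (subst degree_add_eq_right) (auto simp: degree_monom_eq)
    then obtain y where "poly ([:- f, -1:] + monom 1 p) y = 0"
      using alg_closed_imp_poly_has_root[of "[:- f, -1:] + monom 1 p"] p2 by auto
    hence y: "y ^ p = y + f" by (simp add: poly_monom algebra_simps)
    \<comment> \<open>Additive Hilbert 90: \<open>f = y ^ p - y\<close> has trace zero, so Frobenius
      fixes \<open>abs_tr m y\<close>, and \<open>abs_tr_frob\<close> puts \<open>y\<close> itself
      into \<open>gf m\<close>.\<close>
    have "abs_tr m (y ^ p) = abs_tr m y ^ p"
      unfolding abs_tr_def p_def by (subst freshmans_dream_sum) (auto simp: mult.commute simp flip: power_mult)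
    hence "abs_tr m y ^ p - abs_tr m y = 0" using xm(3) by (simp add: y abs_tr_add f_def[symmetric])
    hence ym: "y \<in> gf m" using abs_tr_frob[of m y] by (simp add: gf_iff p_def)
    \<comment> \<open>The roots of the Artin-Schreier equation are the translates of
      \<open>y\<close> by the prime field.\<close>
    define Ws where "Ws = (\<lambda>c. x * (y + of_nat c)) ` {..<p}"
    have "inj_on (\<lambda>c. x * (y + of_nat c)) {..<p}"
      using xm(2) by (auto simp: inj_on_def of_nat_eq_iff_cong_CHAR cong_less_modulus_unique_nat p_def)
    hence cardW: "card Ws = p" by (simp add: Ws_def card_image)
    have Wz: "(\<Sum>n\<le>D. d n * wt_mon p n x w) = 0" if wW: "w \<in> Ws" for w
    proof (rule vanish[rule_format, folded gf_s])
      obtain c :: nat where w: "w = x * (y + of_nat c)" using wW by (auto simp: Ws_def)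
      have "(of_nat c :: 'b) ^ p = of_nat c" using gf_of_nat[of c 1, where 'a='b] by (simp add: gf_iff p_def)
      hence "w ^ p = x ^ p * (y + of_nat c) + x ^ p * f"
        unfolding w power_mult_distrib p_def freshmans_dream[OF CHAR_prime refl]
        by (simp add: y[unfolded p_def] algebra_simps)
      thus "on_curve x w" unfolding on_curve_def w f_def using p2 xm(2)
        by (cases p) (auto simp: algebra_simps)
      show "w \<in> gf m" unfolding w by (intro gf_closed xm ym)
    qed (rule xm)
    define P where "P = (\<Sum>n\<le>D. monom (d n * x ^ (n div p - n mod p)) (n mod p))"
    have "poly P w = 0" if "w \<in> Ws" for w
      using Wz[OF that] by (simp add: P_def poly_sum poly_monom wt_mon_def mult.assoc)
    moreover have "degree P < p" unfolding P_def using p2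
      by (intro degree_sum_less) (auto intro: le_less_trans[OF degree_monom_le])
    ultimately have "P = 0" using p2 cardW by (intro poly_eqI_degree[of Ws]) auto
    hence "0 = coeff P i" by simp
    also have "\<dots> = (\<Sum>n\<le>D. if n mod p = i then d n * x ^ (n div p - i) else 0)"
      unfolding P_def coeff_sum by (intro sum.cong refl) auto
    also have "\<dots> = (\<Sum>n\<in>{n. n \<le> D \<and> n mod p = i}. d n * x ^ (n div p - i))"
      by (subst sum.inter_filter[symmetric]) (auto intro!: sum.cong)
    finally show ?thesis by simp
  qed
  define N where "N = {n. n \<le> D \<and> n mod p = i}"
  have finN: "finite N" unfolding N_def by (rule finite_subset[of _ "{..D}"]) auto
  define R where "R = (\<Sum>n\<in>N. monom (d n) (n div p - i))"
  have "coeff R (n0 div p - i) = (\<Sum>n\<in>N. if n = n0 then d n0 else 0)"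
    unfolding R_def coeff_sum coeff_monom
  proof (intro sum.cong refl)
    fix n assume n: "n \<in> N"
    \<comment> \<open>For valid weights the subtraction is not truncated, so the power of
      \<open>x\<close> and the residue \<open>i\<close> determine the weight and nothing cancels in
      \<open>R\<close>.\<close>
    have "n = n0" if "d n \<noteq> 0" "n div p - i = n0 div p - i"
    proof -
      have "i \<le> n div p" "i \<le> n0 div p"
        using d[rule_format, OF that(1)] d[rule_format, OF n0(2)] n by (auto simp: valid_wt_def N_def i_def)
      hence "n div p = n0 div p" using that(2) by simp
      moreover have "n mod p = n0 mod p" using n by (simp add: N_def i_def)
      ultimately show ?thesis by (metis div_mult_mod_eq)
    qed
    thus "(if n div p - i = n0 div p - i then d n else 0) = (if n = n0 then d n0 else 0)" by auto
  qed
  also have "\<dots> = d n0" using finN n0 by (simp add: sum.delta N_def i_def)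
  finally have R0: "R \<noteq> 0" using n0 by auto
  have degR: "degree R \<le> D div p" unfolding R_def
  proof (intro degree_sum_le finN)
    fix n assume "n \<in> N"
    hence "n div p - i \<le> D div p" by (auto simp: N_def intro: le_trans[OF diff_le_self] div_le_mono)
    thus "degree (monom (d n) (n div p - i)) \<le> D div p" using degree_monom_le le_trans by blast
  qed
  have "Xs \<subseteq> {x. poly R x = 0}"
    using coeff_0 by (auto simp: R_def N_def poly_sum poly_monom)
  hence "card Xs \<le> card {x. poly R x = 0}" using R0 by (intro card_mono poly_roots_finite)
  also have "\<dots> \<le> D div p" using card_poly_roots_bound[OF R0] degR by simp
  finally have "p * card Xs \<le> p * (D div p)" by simp
  also have "\<dots> \<le> D" by simp
  finally show ?thesis by (simp add: Xs_def D_def s_def p_def m_def)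
qed

subsection \<open>The Weil bound\<close>

lemma sum_gf_1_chi: "(\<Sum>t\<in>gf 1. chi (t :: 'b::{alg_closed_field,field_prime_char})) = 0"
  using sum_psi[of 1 "1::'b"] by (simp add: psi_def abs_tr_def del: One_nat_def)

text \<open>An upper bound for the fibres of the trace suffices. Each has at most
  \<open>U / p\<close> elements and together they have \<open>s\<^sup>2 - 1\<close>, so their
  deficits are nonnegative with total \<open>(2 * p\<^sup>2 + 4) * s + 1\<close>. As
  \<open>chi\<close> sums to zero over the prime field, the Kloosterman sum can be computed from the
  deficits alone.\<close>

lemma norm_kloosterman_le_weak:
  fixes a b :: "'b::{alg_closed_field,field_prime_char}"
  assumes h: "h > 0" and large: "(CHAR('b)\<^sup>2 + 3)\<^sup>2 \<le> CHAR('b) ^ h"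
    and a: "a \<in> gf (2 * h)" "a \<noteq> 0" and b: "b \<in> gf (2 * h)"
  shows "norm (kloosterman (2 * h) a b) \<le> (2 * real CHAR('b) ^ 2 + 5) * real CHAR('b) ^ h"
proof -
  define p where "p = CHAR('b)"
  define m where "m = 2 * h"
  define s where "s = p ^ h"
  define F where "F = gf m - {0::'b}"
  define f where "f = (\<lambda>x. abs_tr m (a * x + b / x))"
  define Nf where "Nf = (\<lambda>t. card {x\<in>F. f x = t})"
  define U where "U = s\<^sup>2 + (2 * p\<^sup>2 + 4) * s"
  have p0: "p > 0" unfolding p_def by simp
  hence s0: "s \<ge> 1" by (simp add: s_def)
  have gf1: "finite (gf 1 :: 'b set)" "card (gf 1 :: 'b set) = p"
    using finite_gf[of 1] card_gf[of 1] by (auto simp: p_def)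
  have finF: "finite F" using h by (simp add: F_def m_def finite_gf)
  have fF: "a * x + b / x \<in> gf m" if "x \<in> F" for x
    using that a b by (auto simp: F_def m_def intro!: gf_closed)
  have f_gf1: "f ` F \<subseteq> gf 1" using fF by (auto simp: f_def simp del: One_nat_def intro: abs_tr_in_gf1)
  have NU: "p * Nf t \<le> U" for t
  proof (cases "\<exists>x0\<in>F. f x0 = t")
    case True
    \<comment> \<open>A point of the fibre supplies an element \<open>a * x0 + b / x0\<close> of
      trace \<open>t\<close> to serve as \<theta>.\<close>
    then obtain x0 where x0: "x0 \<in> F" "f x0 = t" by blast
    have "{x\<in>F. f x = t} = {x \<in> gf m - {0}. abs_tr m (a * x + b / x - (a * x0 + b / x0)) = 0}"
      using x0 by (auto simp: F_def f_def abs_tr_diff)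
    thus ?thesis using card_trace_fibre_le[OF h large a b] fF[OF x0(1)]
      by (simp add: Nf_def U_def s_def p_def m_def)
  next
    case False
    hence empty: "{x\<in>F. f x = t} = {}" by blast
    show ?thesis unfolding Nf_def empty by simp
  qed
  have sumN: "(\<Sum>t\<in>gf 1. Nf t) = card F"
    unfolding Nf_def using sum.group[OF finF gf1(1) f_gf1, of "\<lambda>_. 1::nat"] by simp
  have cF: "real (card F) = real s ^ 2 - 1"
  proof -
    have "card F = s\<^sup>2 - 1" using h unfolding F_def
      by (simp add: card_Diff_singleton card_gf m_def s_def p_def mult.commute flip: power_mult)
    thus ?thesis using s0 by (simp add: of_nat_diff)
  qed
  have "kloosterman m a b = (\<Sum>x\<in>F. chi (f x))"
    by (simp add: kloosterman_def F_def f_def psi_def)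
  also have "\<dots> = (\<Sum>t\<in>gf 1. \<Sum>x\<in>{x\<in>F. f x = t}. chi (f x))"
    by (rule sum.group[symmetric, OF finF gf1(1) f_gf1])
  also have "\<dots> = (\<Sum>t\<in>gf 1. of_nat (Nf t) * chi t)" by (simp add: Nf_def)
  finally have K: "kloosterman m a b = (\<Sum>t\<in>gf 1. of_nat (Nf t) * chi t)" .
  have "(\<Sum>t\<in>gf 1. of_nat (U - p * Nf t) * chi t)
      = of_nat U * (\<Sum>t\<in>gf 1. chi (t::'b)) - of_nat p * kloosterman m a b"
    using NU unfolding K
    by (simp add: of_nat_diff left_diff_distrib sum_subtractf sum_distrib_left mult.assoc)
  hence "real p * norm (kloosterman m a b) = norm (\<Sum>t\<in>gf 1. of_nat (U - p * Nf t) * chi (t::'b))"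
    unfolding sum_gf_1_chi by (simp add: norm_mult)
  also have "\<dots> \<le> (\<Sum>t\<in>gf 1. norm (of_nat (U - p * Nf t) * chi (t::'b)))" by (rule norm_sum)
  also have "\<dots> = (\<Sum>t\<in>gf 1. real U - real p * real (Nf (t::'b)))"
  proof (intro sum.cong refl)
    fix t :: 'b
    have "norm (of_nat (U - p * Nf t) * chi t) = real (U - p * Nf t)"
      by (simp only: norm_mult norm_of_nat norm_chi mult_1_right)
    also have "\<dots> = real U - real p * real (Nf t)" using NU by (simp add: of_nat_diff)
    finally show "norm (of_nat (U - p * Nf t) * chi t) = real U - real p * real (Nf t)" .
  qed
  also have "\<dots> = real p * real U - real p * real (card F)"
    by (simp only: sum_subtractf sum_constant gf1 flip: sum_distrib_left sumN of_nat_sum)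
  also have "\<dots> = real p * ((2 * real p ^ 2 + 4) * real s + 1)"
    unfolding cF by (simp add: U_def algebra_simps)
  finally have "norm (kloosterman m a b) \<le> (2 * real p ^ 2 + 4) * real s + 1" using p0 by simp
  also have "\<dots> \<le> (2 * real p ^ 2 + 5) * real s" using s0 by (simp add: algebra_simps)
  finally show ?thesis by (simp add: m_def s_def p_def)
qed

text \<open>An excess over 2 of the normalised sum \<open>t\<close> at least quadruples with each
  quadratic extension, because \<open>(2 + e)\<^sup>2 - 2 \<ge> 2 + 4 * e\<close>. The weak bound
  keeps \<open>t\<close> below the fixed constant \<open>C\<close> at high levels of the
  tower.\<close>

theorem weil_bound_kloosterman:
  fixes a b :: "'b::{alg_closed_field,field_prime_char}"
  assumes m: "m > 0" and a: "a \<in> gf m" "a \<noteq> 0" and b: "b \<in> gf m" "b \<noteq> 0"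
  shows "norm (kloosterman m a b) \<le> 2 * sqrt (real CHAR('b) ^ m)"
proof (rule ccontr)
  define p where "p = real CHAR('b)"
  have p2: "p \<ge> 2" using CHAR_ge_2[where 'b='b] by (simp add: p_def)
  define M where "M = (\<lambda>j::nat. 2 ^ j * m)"
  define t where "t = (\<lambda>j. norm (kloosterman (M j) a b) / sqrt p ^ M j)"
  define \<delta> where "\<delta> = t 0 - 2"
  define C where "C = 2 * p ^ 2 + 5"
  assume "\<not> ?thesis"
  hence \<delta>: "\<delta> > 0" using p2 by (simp add: \<delta>_def t_def M_def p_def real_sqrt_power field_simps)
  have M0: "M j > 0" for j using m by (simp add: M_def)
  have M_Suc: "M (Suc j) = 2 * M j" for j by (simp add: M_def)
  have gfM: "a \<in> gf (M j)" "b \<in> gf (M j)" for j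
    using a(1) b(1) gf_dvd_mono[of m "M j"] by (auto simp: M_def)
  have step: "t (Suc j) \<ge> (t j)\<^sup>2 - 2" for j
  proof -
    let ?K = "kloosterman (M j) a b"
    have sq: "sqrt p ^ (2 * M j) = p ^ M j" using p2 by (simp add: power_mult)
    have sq': "(sqrt p ^ M j)\<^sup>2 = p ^ M j" by (simp only: power_mult[symmetric] mult.commute[of "M j" 2] sq)
    have "norm ?K ^ 2 - 2 * p ^ M j = norm (?K\<^sup>2) - norm (2 * of_nat (CHAR('b) ^ M j) :: complex)"
      by (simp add: norm_power norm_mult p_def)
    also have "\<dots> \<le> norm (?K\<^sup>2 - 2 * of_nat (CHAR('b) ^ M j))" by (rule norm_triangle_ineq2)
    also have "\<dots> = norm (kloosterman (M (Suc j)) a b)"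
      unfolding M_Suc kloosterman_double[OF M0 gfM(1) a(2) gfM(2) b(2)] by (rule norm_minus_commute)
    finally have "(norm ?K ^ 2 - 2 * p ^ M j) / p ^ M j \<le> t (Suc j)"
      using p2 by (simp add: t_def M_Suc sq divide_right_mono)
    thus ?thesis using p2 by (simp add: t_def power_divide sq' diff_divide_distrib)
  qed
  have grow: "t j \<ge> 2 + 4 ^ j * \<delta>" for j
  proof (induction j)
    case (Suc j)
    have "2 + 4 ^ Suc j * \<delta> \<le> (2 + 4 ^ j * \<delta>)\<^sup>2 - 2"
      using zero_le_power2[of "4 ^ j * \<delta>"] by (simp add: power2_eq_square algebra_simps)
    also have "\<dots> \<le> (t j)\<^sup>2 - 2" using Suc \<delta> by (intro diff_right_mono power_mono) auto
    also have "\<dots> \<le> t (Suc j)" by (rule step)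
    finally show ?case .
  qed (simp add: \<delta>_def)
  obtain k where k: "C / \<delta> < 4 ^ k" using real_arch_pow[of 4 "C / \<delta>"] by auto
  \<comment> \<open>The first summand makes the excess surpass \<open>C\<close>; the second makes
    the field large enough for the weak bound. That bound concerns degree \<open>2 * h\<close>,
    hence level \<open>Suc i\<close>.\<close>
  define i where "i = k + (CHAR('b)\<^sup>2 + 3)\<^sup>2"
  define h where "h = M i"
  have "(CHAR('b)\<^sup>2 + 3)\<^sup>2 \<le> i" by (simp add: i_def)
  also have "i \<le> 2 ^ i" by simp
  also have "\<dots> \<le> h" using m by (simp add: h_def M_def)
  also have "\<dots> \<le> 2 ^ h" by simp
  also have "\<dots> \<le> CHAR('b) ^ h" using CHAR_ge_2 by (intro power_mono) auto
  finally have large: "(CHAR('b)\<^sup>2 + 3)\<^sup>2 \<le> CHAR('b) ^ h" .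
  have "norm (kloosterman (2 * h) a b) \<le> C * p ^ h"
    unfolding C_def p_def
    by (rule norm_kloosterman_le_weak[OF _ large _ a(2)]) (use M0 gfM[of "Suc i"] in \<open>auto simp: h_def M_Suc\<close>)
  hence "t (Suc i) \<le> C" using p2 by (simp add: t_def M_Suc h_def power_mult divide_le_eq)
  moreover have "C < 4 ^ k * \<delta>" using k \<delta> by (simp add: divide_less_eq)
  moreover have "4 ^ k * \<delta> \<le> 4 ^ Suc i * \<delta>"
    using \<delta> by (intro mult_right_mono power_increasing) (auto simp: i_def)
  ultimately show False using grow[of "Suc i"] by linarith
qed

text \<open>The complete character sum is zero and its missing term at 0 is 1; inversion of
  \<open>x\<close> exchanges the two cases.\<close>

lemma kloosterman_0:
  fixes b :: "'b::{alg_closed_field,field_prime_char}"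
  assumes "m > 0" "b \<in> gf m" "b \<noteq> 0"
  shows "kloosterman m 0 b = - 1" and "kloosterman m b 0 = - 1"
proof -
  have fin: "finite (gf m :: 'b set)" using assms by (simp add: finite_gf)
  have "(\<Sum>x\<in>gf m. psi m (x * b)) = 0" using sum_psi[OF assms(1,2)] assms(3) by simp
  hence *: "(\<Sum>x\<in>gf m - {0}. psi m (b * x)) = - 1"
    using fin by (simp add: sum.remove[of _ 0] mult.commute add_eq_0_iff)
  thus "kloosterman m b 0 = - 1" by (simp add: kloosterman_def)
  have "kloosterman m 0 b = (\<Sum>x\<in>gf m - {0}. psi m (b / x))" by (simp add: kloosterman_def)
  also have "\<dots> = (\<Sum>x\<in>gf m - {0}. psi m (b * x))"
    by (rule sum.reindex_bij_witness[of _ "\<lambda>x. 1 / x" "\<lambda>x. 1 / x"]) (auto intro!: gf_closed)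
  finally show "kloosterman m 0 b = - 1" using * by simp
qed

subsection \<open>Elements with prescribed traces\<close>

lemma ex_rel_tr_nonzero:
  assumes "d > 0" "l > 0"
  shows "\<exists>u\<in>gf (d * l). rel_tr d l u \<noteq> (0::'b::{alg_closed_field,field_prime_char})"
proof -
  obtain u :: 'b where "u \<in> gf (d * l)" "abs_tr (d * l) u \<noteq> 0"
    using ex_abs_tr_nonzero[of "d * l"] assms by auto
  thus ?thesis using abs_tr_rel_tr[of 1 d l u] by (intro bexI[of _ u]) auto
qed

text \<open>Prescribing the values as traces of \<open>u1\<close> and \<open>u2\<close> turns the
  conditions into vanishing traces of \<open>x - u1\<close> and \<open>\<beta> / x - u2\<close>,
  which characters detect. With Q = p^m, the pair (0, 0) contributes Q - 1 and the pairs with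
  exactly one zero contribute 1 on each side. If no \<open>x\<close> existed, the remaining pairs
  would have to sum to -(Q + 1), which the Weil bound forbids.\<close>

lemma ex_prescribed_rel_tr:
  fixes \<beta> u1 u2 :: "'b::{alg_closed_field,field_prime_char}"
  assumes d: "d1 > 0" "d2 > 0" and N: "m = d1 * l1" "m = d2 * l2"
    and large: "2 * (d1 + d2 + 1) \<le> m"
    and \<beta>: "\<beta> \<in> gf m" "\<beta> \<noteq> 0"
    and u: "u1 \<in> gf m" "rel_tr d1 l1 u1 \<noteq> 0" "u2 \<in> gf m" "rel_tr d2 l2 u2 \<noteq> 0"
  shows "\<exists>x\<in>gf m - {0}. rel_tr d1 l1 x = rel_tr d1 l1 u1 \<and> rel_tr d2 l2 (\<beta> / x) = rel_tr d2 l2 u2"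
proof (rule ccontr)
  assume none: "\<not> ?thesis"
  define p where "p = real CHAR('b)"
  define A where "A = (gf d1 :: 'b set)"
  define B where "B = (gf d2 :: 'b set)"
  define F where "F = gf m - {0::'b}"
  define \<psi> where "\<psi> = (psi m :: 'b \<Rightarrow> complex)"
  define T where "T = (\<lambda>a b. \<psi> (a * (- u1)) * \<psi> (b * (- u2)) * kloosterman m a (b * \<beta>))"
  have m0: "m > 0" using large by simp
  have p2: "p \<ge> 2" using CHAR_ge_2[where 'b='b] by (simp add: p_def)
  have AB: "A \<subseteq> gf m" "B \<subseteq> gf m"
    unfolding A_def B_def by (rule gf_dvd_mono, simp add: N(1)) (rule gf_dvd_mono, simp add: N(2))
  have fin: "finite A" "finite B" "finite F" using d m0 by (simp_all add: A_def B_def F_def finite_gf)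
  have rdiff: "rel_tr d l (x - y) = rel_tr d l x - rel_tr d l y" for d l and x y :: 'b
    by (simp add: rel_tr_def frob_diff sum_subtractf)
  have sumA: "(\<Sum>a\<in>A. \<psi> (a * z)) = (if rel_tr d1 l1 z = 0 then of_nat (CHAR('b) ^ d1) else 0)"
    if "z \<in> gf m" for z
    unfolding A_def \<psi>_def N(1) by (rule sum_psi_subfield) (use that d N in auto)
  have sumB: "(\<Sum>b\<in>B. \<psi> (b * z)) = (if rel_tr d2 l2 z = 0 then of_nat (CHAR('b) ^ d2) else 0)"
    if "z \<in> gf m" for z
    unfolding B_def \<psi>_def N(2) by (rule sum_psi_subfield) (use that d N in auto)
  have runeg: "rel_tr d l (- x) = - rel_tr d l x" for d l and x :: 'b
    by (simp add: rel_tr_def frob_uminus sum_negf)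
  have "0 = (\<Sum>x\<in>F. (\<Sum>a\<in>A. \<psi> (a * (x - u1))) * (\<Sum>b\<in>B. \<psi> (b * (\<beta> / x - u2))))"
  proof (rule sum.neutral[symmetric], intro ballI)
    fix x assume x: "x \<in> F"
    hence "x - u1 \<in> gf m" "\<beta> / x - u2 \<in> gf m" using u \<beta> by (auto simp: F_def intro!: gf_closed)
    moreover have "rel_tr d1 l1 x \<noteq> rel_tr d1 l1 u1 \<or> rel_tr d2 l2 (\<beta> / x) \<noteq> rel_tr d2 l2 u2"
      using none x by (auto simp: F_def)
    ultimately show "(\<Sum>a\<in>A. \<psi> (a * (x - u1))) * (\<Sum>b\<in>B. \<psi> (b * (\<beta> / x - u2))) = 0"
      by (auto simp: sumA sumB rdiff)
  qed
  also have "\<dots> = (\<Sum>x\<in>F. \<Sum>a\<in>A. \<Sum>b\<in>B. \<psi> (a * (- u1)) * \<psi> (b * (- u2)) * \<psi> (a * x + b * \<beta> / x))"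
    unfolding sum_product
  proof (intro sum.cong refl)
    fix x a b assume x: "x \<in> F" and "a \<in> A" "b \<in> B"
    hence ab: "a \<in> gf m" "b \<in> gf m" using AB by auto
    have "\<psi> (a * (x - u1)) = \<psi> (a * x) * \<psi> (a * (- u1))"
      unfolding \<psi>_def using ab u x by (subst psi_add[symmetric]) (auto simp: F_def algebra_simps intro!: gf_closed)
    moreover have "\<psi> (b * (\<beta> / x - u2)) = \<psi> (b * \<beta> / x) * \<psi> (b * (- u2))"
      unfolding \<psi>_def using ab u x \<beta> by (subst psi_add[symmetric]) (auto simp: F_def algebra_simps intro!: gf_closed)
    moreover have "\<psi> (a * x + b * \<beta> / x) = \<psi> (a * x) * \<psi> (b * \<beta> / x)"
      unfolding \<psi>_def using ab x \<beta> by (intro psi_add) (auto simp: F_def intro!: gf_closed)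
    ultimately show "\<psi> (a * (x - u1)) * \<psi> (b * (\<beta> / x - u2))
        = \<psi> (a * (- u1)) * \<psi> (b * (- u2)) * \<psi> (a * x + b * \<beta> / x)" by (simp add: mult_ac)
  qed
  also have "\<dots> = (\<Sum>a\<in>A. \<Sum>b\<in>B. T a b)"
    unfolding T_def kloosterman_def sum_distrib_left F_def[symmetric] \<psi>_def[symmetric]
    by (subst sum.swap[where A = F and B = A], rule sum.cong[OF refl], rule sum.swap)
  also have "\<dots> = (\<Sum>b\<in>B. T 0 b) + (\<Sum>a\<in>A-{0}. \<Sum>b\<in>B. T a b)"
    using fin by (intro sum.remove) (auto simp: A_def)
  also have "(\<Sum>a\<in>A-{0}. \<Sum>b\<in>B. T a b) = (\<Sum>a\<in>A-{0}. T a 0) + (\<Sum>a\<in>A-{0}. \<Sum>b\<in>B-{0}. T a b)"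
    using fin by (subst sum.remove[of B 0]) (auto simp: B_def sum.distrib)
  also have "(\<Sum>b\<in>B. T 0 b) = T 0 0 + (\<Sum>b\<in>B-{0}. T 0 b)"
    using fin by (intro sum.remove) (auto simp: B_def)
  also have "T 0 0 = of_nat (CHAR('b) ^ m) - 1"
  proof -
    have "card F = CHAR('b) ^ m - 1" using m0 by (simp add: F_def card_Diff_singleton card_gf)
    moreover have "CHAR('b) ^ m \<ge> 1" by (simp add: Suc_le_eq)
    ultimately have "of_nat (card F) = of_nat (CHAR('b) ^ m) - (1 :: complex)" by (metis of_nat_1 of_nat_diff)
    thus ?thesis by (simp add: T_def kloosterman_def F_def \<psi>_def)
  qed
  also have "(\<Sum>b\<in>B-{0}. T 0 b) = 1"
  proof -
    have "(\<Sum>b\<in>B-{0}. T 0 b) = - (\<Sum>b\<in>B-{0}. \<psi> (b * (- u2)))"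
      unfolding sum_negf[symmetric]
    proof (intro sum.cong refl)
      fix b assume "b \<in> B - {0}"
      hence "kloosterman m 0 (b * \<beta>) = - 1" using AB \<beta> m0 by (intro kloosterman_0) (auto intro!: gf_closed)
      thus "T 0 b = - \<psi> (b * (- u2))" by (simp add: T_def \<psi>_def)
    qed
    moreover have "(\<Sum>b\<in>B. \<psi> (b * (- u2))) = \<psi> (0 * (- u2)) + (\<Sum>b\<in>B-{0}. \<psi> (b * (- u2)))"
      using fin by (intro sum.remove) (auto simp: B_def)
    moreover have "(\<Sum>b\<in>B. \<psi> (b * (- u2))) = 0" using u by (subst sumB) (auto simp: runeg intro: gf_closed)
    ultimately show ?thesis by (simp add: \<psi>_def add_eq_0_iff)
  qed
  also have "(\<Sum>a\<in>A-{0}. T a 0) = 1"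
  proof -
    have "(\<Sum>a\<in>A-{0}. T a 0) = - (\<Sum>a\<in>A-{0}. \<psi> (a * (- u1)))"
      unfolding sum_negf[symmetric]
    proof (intro sum.cong refl)
      fix a assume "a \<in> A - {0}"
      hence "kloosterman m a 0 = - 1" using AB m0 by (intro kloosterman_0) auto
      thus "T a 0 = - \<psi> (a * (- u1))" by (simp add: T_def \<psi>_def)
    qed
    moreover have "(\<Sum>a\<in>A. \<psi> (a * (- u1))) = \<psi> (0 * (- u1)) + (\<Sum>a\<in>A-{0}. \<psi> (a * (- u1)))"
      using fin by (intro sum.remove) (auto simp: A_def)
    moreover have "(\<Sum>a\<in>A. \<psi> (a * (- u1))) = 0" using u by (subst sumA) (auto simp: runeg intro: gf_closed)
    ultimately show ?thesis by (simp add: \<psi>_def add_eq_0_iff)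
  qed
  finally have "(\<Sum>a\<in>A-{0}. \<Sum>b\<in>B-{0}. T a b) = - of_nat (CHAR('b) ^ m + 1)"
    by (simp add: algebra_simps add_eq_0_iff)
  hence "p ^ m + 1 = norm (\<Sum>a\<in>A-{0}. \<Sum>b\<in>B-{0}. T a b)"
    by (simp only: norm_minus_cancel norm_of_nat p_def) simp
  also have "\<dots> \<le> (\<Sum>a\<in>A-{0}. \<Sum>b\<in>B-{0}. 2 * sqrt (p ^ m))"
  proof (intro order_trans[OF norm_sum] sum_mono)
    fix a b assume "a \<in> A - {0}" "b \<in> B - {0}"
    hence "a \<in> gf m" "a \<noteq> 0" "b * \<beta> \<in> gf m" "b * \<beta> \<noteq> 0" using AB \<beta> by (auto intro: gf_closed)
    thus "norm (T a b) \<le> 2 * sqrt (p ^ m)"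
      using weil_bound_kloosterman[OF m0, of a "b * \<beta>"] by (simp add: T_def norm_mult \<psi>_def p_def)
  qed
  also have "\<dots> = real (card (A-{0}) * card (B-{0})) * (2 * sqrt (p ^ m))" by simp
  also have "\<dots> \<le> real (card A * card B) * (2 * sqrt (p ^ m))"
    using fin p2 by (intro mult_right_mono of_nat_mono mult_le_mono card_mono) auto
  also have "real (card A * card B) = p ^ (d1 + d2)"
    using d by (simp add: A_def B_def card_gf p_def power_add)
  \<comment> \<open>The constant 2 of the Weil bound is absorbed into one further power of
    \<open>p\<close>, which accounts for the 1 in \<open>large\<close>.\<close>
  also have "p ^ (d1 + d2) * (2 * sqrt (p ^ m)) \<le> p ^ (d1 + d2) * (p * sqrt (p ^ m))"
    using p2 by (intro mult_left_mono mult_right_mono) auto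
  also have "\<dots> = p ^ (d1 + d2 + 1) * sqrt (p ^ m)" by simp
  also have "\<dots> \<le> sqrt (p ^ m) * sqrt (p ^ m)"
  proof (intro mult_right_mono real_le_rsqrt)
    have "(p ^ (d1 + d2 + 1))\<^sup>2 = p ^ (2 * (d1 + d2 + 1))" by (simp only: power_mult[symmetric] mult.commute)
    thus "(p ^ (d1 + d2 + 1))\<^sup>2 \<le> p ^ m" using p2 large by (simp only:) (intro power_increasing; simp)
  qed (use p2 in auto)
  also have "\<dots> = p ^ m" using p2 by simp
  finally show False by simp
qed

lemma ex_rel_tr_product:
  fixes \<alpha> :: "'b::{alg_closed_field,field_prime_char}"
  assumes d: "d1 > 0" "d2 > 0" and N: "m = d1 * l1" "m = d2 * l2"
    and large: "2 * (d1 + d2 + 1) \<le> m" and \<alpha>: "\<alpha> \<in> gf m" "\<alpha> \<noteq> 0"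
  shows "\<exists>x\<in>gf m - {0}. \<exists>y\<in>gf m - {0}. x * y = \<alpha> * rel_tr d1 l1 x * rel_tr d2 l2 y"
proof -
  have l: "l1 > 0" "l2 > 0" using N large by (cases "l1 = 0"; cases "l2 = 0"; simp)+
  obtain u1 u2 :: 'b where u: "u1 \<in> gf m" "rel_tr d1 l1 u1 \<noteq> 0" "u2 \<in> gf m" "rel_tr d2 l2 u2 \<noteq> 0"
    using ex_rel_tr_nonzero[OF d(1) l(1)] ex_rel_tr_nonzero[OF d(2) l(2)] N by metis
  define \<beta> where "\<beta> = \<alpha> * rel_tr d1 l1 u1 * rel_tr d2 l2 u2"
  have "d1 dvd m" using N(1) by simp
  moreover have "d2 dvd m" using N(2) by simp
  ultimately have "rel_tr d1 l1 u1 \<in> gf m" "rel_tr d2 l2 u2 \<in> gf m"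
    using rel_tr_in_gf[of u1 d1 l1, folded N(1), OF u(1)] rel_tr_in_gf[of u2 d2 l2, folded N(2), OF u(3)]
      gf_dvd_mono[of d1 m, where 'b='b] gf_dvd_mono[of d2 m, where 'b='b] by auto
  hence \<beta>: "\<beta> \<in> gf m" "\<beta> \<noteq> 0" using \<alpha> u by (auto simp: \<beta>_def intro!: gf_closed)
  obtain x where x: "x \<in> gf m - {0}" "rel_tr d1 l1 x = rel_tr d1 l1 u1" "rel_tr d2 l2 (\<beta> / x) = rel_tr d2 l2 u2"
    using ex_prescribed_rel_tr[OF d N large \<beta> u] by blast
  have "x * (\<beta> / x) = \<alpha> * rel_tr d1 l1 x * rel_tr d2 l2 (\<beta> / x)" using x by (simp add: \<beta>_def)
  moreover have "\<beta> / x \<in> gf m - {0}" using x \<beta> by (auto intro: gf_closed)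
  ultimately show ?thesis using x(1) by blast
qed

section \<open>Embedding the given field in its algebraic closure\<close>

instance alg_closure :: ("{field,finite}") field_prime_char
proof (rule field_prime_charI')
  show "CHAR('a alg_closure) > 0" using finite_imp_CHAR_pos[where 'a='a] by simp
qed

text \<open>Multiplication by a nonzero \<open>x\<close> permutes the nonzero elements and so
  preserves their product.\<close>

lemma power_card_eq_same: "(x :: 'a::{field,finite}) ^ card (UNIV :: 'a set) = x"
proof (cases "x = 0")
  case False
  have "(\<Prod>y\<in>UNIV-{0}. y) = (\<Prod>y\<in>UNIV-{0}. x * y)"
    by (rule prod.reindex_bij_witness[of _ "\<lambda>y. x * y" "\<lambda>y. y / x"]) (use False in auto)
  also have "\<dots> = x ^ card (UNIV - {0::'a}) * (\<Prod>y\<in>UNIV-{0}. y)" by (simp add: prod.distrib)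
  finally have "x ^ card (UNIV - {0::'a}) = 1" by simp
  moreover have "card (UNIV :: 'a set) = Suc (card (UNIV - {0::'a}))" by (rule card.remove) auto
  ultimately show ?thesis by (simp only: power_Suc mult_1_right)
qed (simp add: power_0_left)

lemma CHAR_eq_of_card:
  assumes "prime p" "card (UNIV :: 'a::{field,finite} set) = p ^ N"
  shows "CHAR('a) = p"
proof -
  have "CHAR('a) > 0" by (rule finite_imp_CHAR_pos) simp
  hence pr: "prime CHAR('a)" by (rule prime_CHAR_semidom)
  have "CHAR('a) dvd p ^ N" using CHAR_dvd_CARD[where 'a='a] assms by simp
  thus ?thesis using pr assms(1) by (metis prime_dvd_power primes_dvd_imp_eq)
qed

text \<open>This transfers solutions found in the closure back to the given field. The inclusion is
  \<open>power_card_eq_same\<close>, and both sets have the same finite size.\<close>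

lemma range_to_ac_eq_gf:
  assumes "card (UNIV :: 'a::{field,finite} set) = CHAR('a) ^ N" "N > 0"
  shows "range (to_ac :: 'a \<Rightarrow> _) = gf N"
proof (rule card_subset_eq)
  show "range (to_ac :: 'a \<Rightarrow> _) \<subseteq> gf N"
    using power_card_eq_same[where 'a='a] by (auto simp: gf_iff assms(1) simp flip: to_ac_power)
  show "card (range (to_ac :: 'a \<Rightarrow> _)) = card (gf N :: 'a alg_closure set)"
    using assms by (simp add: card_image[OF inj_to_ac] card_gf)
qed (use assms in \<open>simp add: finite_gf\<close>)

subsection \<open>Intersection of the linear sets\<close>

lemma proj_point_scale: "c \<noteq> 0 \<Longrightarrow> proj_point (c * a, c * b) = proj_point (a, b)"
proof -
  assume "c \<noteq> 0"
  hence "\<exists>c'. (k * a, k * b) = (c' * (c * a), c' * (c * b)) \<and> c' \<noteq> 0" if "k \<noteq> 0" for k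
    using that by (intro exI[of _ "k / c"]) auto
  moreover have "\<exists>c'. (k * (c * a), k * (c * b)) = (c' * a, c' * b) \<and> c' \<noteq> 0" if "k \<noteq> 0" for k
    using that \<open>c \<noteq> 0\<close> by (intro exI[of _ "k * c"]) auto
  ultimately show ?thesis unfolding proj_point_def by auto
qed

theorem theorem3p5:
  fixes q n r1 r2 :: nat and \<alpha> :: "'a::{field,finite}"
  assumes "\<exists>p k. prime p \<and> k > 0 \<and> q = p ^ k"
    and "card (UNIV :: 'a set) = q ^ n"
    and "n \<ge> 2"
    and "r1 > 0" "r1 dvd n" "r2 > 0" "r2 dvd n"
    and "\<alpha> \<noteq> 0"
    and "2 * (r1 + r2 + 1) \<le> n"
  shows "L_set q n r1 \<inter>
           {proj_point (\<alpha> * rtrace q n r2 y, y) | y. y \<noteq> (0::'a)} \<noteq> {}"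
proof -
  obtain p k where q: "prime p" "k > 0" "q = p ^ k" using assms(1) by blast
  define N where "N = k * n"
  have card: "card (UNIV :: 'a set) = p ^ N" using assms(2) q by (simp add: N_def power_mult)
  have p: "CHAR('a) = p" by (rule CHAR_eq_of_card[OF q(1) card])
  have N0: "N > 0" using q assms(3) by (simp add: N_def)
  have range: "range (to_ac :: 'a \<Rightarrow> _) = gf N" by (rule range_to_ac_eq_gf) (use card p N0 in auto)
  \<comment> \<open>As \<open>q = p ^ k\<close>, raising to the power \<open>q ^ r\<close> is the
    \<open>k * r\<close>-th power of Frobenius.\<close>
  have tr: "to_ac (rtrace q n r z) = rel_tr (k * r) (n div r) (to_ac z)" for r and z :: 'a
    by (simp add: rtrace_def rel_tr_def to_ac_sum p q(3) mult_ac flip: power_mult)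
  have "k * (2 * (r1 + r2 + 1)) \<le> k * n" using assms(9) by (rule mult_le_mono2)
  hence large: "2 * (k * r1 + k * r2 + 1) \<le> N" using q(2) by (simp add: N_def algebra_simps)
  have "\<exists>x\<in>gf N - {0}. \<exists>y\<in>gf N - {0}. x * y =
      to_ac \<alpha> * rel_tr (k * r1) (n div r1) x * rel_tr (k * r2) (n div r2) y"
    by (rule ex_rel_tr_product) (use assms q large range in \<open>auto simp: N_def\<close>)
  then obtain x y :: 'a where "to_ac x \<noteq> 0" "to_ac y \<noteq> 0" and
    "to_ac x * to_ac y = to_ac \<alpha> * to_ac (rtrace q n r1 x) * to_ac (rtrace q n r2 y)"
    unfolding range[symmetric] tr by blast
  hence xy: "x \<noteq> 0" "y \<noteq> 0" "x * y = \<alpha> * rtrace q n r1 x * rtrace q n r2 y"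
    by (simp_all flip: to_ac_mult)
  \<comment> \<open>The scalar is chosen to match the first coordinates; the equation for
    \<open>x * y\<close> then matches the second ones.\<close>
  define c where "c = x / (\<alpha> * rtrace q n r2 y)"
  have nz: "rtrace q n r2 y \<noteq> 0" using xy by auto
  have "c * (\<alpha> * rtrace q n r2 y) = x" "c * y = rtrace q n r1 x" "c \<noteq> 0"
    using xy nz assms(8) by (simp_all add: c_def field_simps)
  hence "proj_point (x, rtrace q n r1 x) = proj_point (\<alpha> * rtrace q n r2 y, y)"
    using proj_point_scale[of c "\<alpha> * rtrace q n r2 y" y] by simp
  thus ?thesis using xy(1,2) unfolding L_set_def by blast
qed

end
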